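(* Every semisimple Boolean inverse semigroup is isomorphic to a restricted direct product of semisimple Boolean inverse semigroups of the form $M_{|X|}(G^{0})$ where $G$ is a group and $X$ is a non-empty set.
   Context: For an inverse semigroup $S$, $\mathsf{E}(S)$ is its set of idempotents. The natural partial order is $a\le b$ iff $a=ba^{-1}a$; joins and meets refer to it; $a^{\downarrow}=\{x: x\le a\}$. Elements $a,b$ are compatible if $a^{-1}b$ and $ab^{-1}$ are both idempotents; when $S$ has a zero they are orthogonal if $a^{-1}b=0=ab^{-1}$. A Boolean algebra here means a generalized Boolean algebra: a distributive lattice with bottom (a top is not required) in which every principal order-ideal is a (unital) Boolean algebra. An inverse semigroup with zero is distributive if any two compatible elements have a join and multiplication distributes on both sides over such joins; it is Boolean if in addition $(\mathsf{E}(S),\le)$ is a Boolean algebra. Boolean inverse semigroups are assumed not to be the zero semigroup $\{0\}$. $S$ is semisimple if $a^{\downarrow}$ is finite for each $a\in S$. An orthogonal join (join of pairwise orthogonal elements) is written $\oplus$. The restricted direct product $\bigoplus_{i\in I}S_i$ of Boolean inverse semigroups $S_i$ ($i\in I$) is the subsemigroup of the direct product $\prod_{i\in I}S_i$ consisting of the elements all of whose components are zero except in finitely many positions. For a group $G$, $G^{0}$ is $G$ with a zero adjoined; it is a Boolean inverse monoid. For a Boolean inverse semigroup $S$ and a non-empty set $X$, $M_{|X|}(S)$ is the set of $|X|\times|X|$ rook matrices over $S$: matrices with rows and columns indexed by $X$, with entries in $S$, such that if $a,b$ lie in the same row and distinct columns then $a^{-1}b=0$, if $a,b$ lie in the same column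 and distinct rows then $ab^{-1}=0$, and (when $X$ is infinite) only finitely many entries are non-zero. Multiplication is $(AB)_{ij}=\bigoplus_{k}a_{ik}b_{kj}$; this makes $M_{|X|}(S)$ a Boolean inverse semigroup. *)

theory Defs
  imports "HOL-Algebra.Group" "HOL-Algebra.Lattice"
begin

section \<open>Generalized Boolean algebras\<close>

definition order_ideal :: "('a, 'b) gorder_scheme \<Rightarrow> 'a \<Rightarrow> 'a set" where
  "order_ideal L a = {x \<in> carrier L. x \<sqsubseteq>\<^bsub>L\<^esub> a}"

locale distributive_lattice = lattice +
  assumes meet_join_distrib:
    "\<lbrakk>x \<in> carrier L; y \<in> carrier L; z \<in> carrier L\<rbrakk>
      \<Longrightarrow> x \<sqinter> (y \<squnion> z) = (x \<sqinter> y) \<squnion> (x \<sqinter> z)"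

locale unital_boolean_algebra =
  distributive_lattice + weak_partial_order_bottom + weak_partial_order_top +
  assumes complement_exists:
    "x \<in> carrier L \<Longrightarrow> \<exists>y \<in> carrier L. x \<sqinter> y = \<bottom> \<and> x \<squnion> y = \<top>"

text \<open>In \<open>order_ideal_boolean\<close> the lattice operations, the bottom and the top are
  those of the principal order-ideal, with the induced order.\<close>

locale generalized_boolean_algebra =
  distributive_lattice + weak_partial_order_bottom +
  assumes order_ideal_boolean:
    "e \<in> carrier L \<Longrightarrow> unital_boolean_algebra (L\<lparr>carrier := order_ideal L e\<rparr>)"


section \<open>Inverse semigroups\<close>

record 'a semigrp = "'a partial_object" +
  sprod :: "['a, 'a] \<Rightarrow> 'a" (infixl \<open>\<cdot>\<index>\<close> 70)

definition is_zero :: "('a, 'm) semigrp_scheme \<Rightarrow> 'a \<Rightarrow> bool" where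
  "is_zero S z \<longleftrightarrow>
    z \<in> carrier S \<and> (\<forall>a \<in> carrier S. z \<cdot>\<^bsub>S\<^esub> a = z \<and> a \<cdot>\<^bsub>S\<^esub> z = z)"

text \<open>Meaningful only if a zero exists.\<close>

definition szero :: "('a, 'm) semigrp_scheme \<Rightarrow> 'a" where
  "szero S = (THE z. is_zero S z)"

definition is_sinv :: "('a, 'm) semigrp_scheme \<Rightarrow> 'a \<Rightarrow> 'a \<Rightarrow> bool" where
  "is_sinv S a b \<longleftrightarrow>
    b \<in> carrier S \<and> a \<cdot>\<^bsub>S\<^esub> b \<cdot>\<^bsub>S\<^esub> a = a \<and> b \<cdot>\<^bsub>S\<^esub> a \<cdot>\<^bsub>S\<^esub> b = b"

text \<open>Meaningful only in an inverse semigroup.\<close>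

definition sinv :: "('a, 'm) semigrp_scheme \<Rightarrow> 'a \<Rightarrow> 'a" where
  "sinv S a = (THE b. is_sinv S a b)"

definition idempotents :: "('a, 'm) semigrp_scheme \<Rightarrow> 'a set" where
  "idempotents S = {e \<in> carrier S. e \<cdot>\<^bsub>S\<^esub> e = e}"

locale inverse_semigroup =
  fixes S (structure)
  assumes prod_closed:
      "\<lbrakk>a \<in> carrier S; b \<in> carrier S\<rbrakk> \<Longrightarrow> a \<cdot> b \<in> carrier S"
    and prod_assoc:
      "\<lbrakk>a \<in> carrier S; b \<in> carrier S; c \<in> carrier S\<rbrakk> \<Longrightarrow> (a \<cdot> b) \<cdot> c = a \<cdot> (b \<cdot> c)"
    and ex1_inverse: "a \<in> carrier S \<Longrightarrow> \<exists>!b. is_sinv S a b"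

definition natural_order :: "('a, 'm) semigrp_scheme \<Rightarrow> 'a gorder" where
  "natural_order S =
    \<lparr>carrier = carrier S, eq = (=), le = (\<lambda>a b. a = b \<cdot>\<^bsub>S\<^esub> sinv S a \<cdot>\<^bsub>S\<^esub> a)\<rparr>"

definition compatible :: "('a, 'm) semigrp_scheme \<Rightarrow> 'a \<Rightarrow> 'a \<Rightarrow> bool" where
  "compatible S a b \<longleftrightarrow>
    sinv S a \<cdot>\<^bsub>S\<^esub> b \<in> idempotents S \<and> a \<cdot>\<^bsub>S\<^esub> sinv S b \<in> idempotents S"

definition is_join :: "('a, 'm) semigrp_scheme \<Rightarrow> 'a \<Rightarrow> 'a set \<Rightarrow> bool" where
  "is_join S s A \<longleftrightarrow> least (natural_order S) s (Upper (natural_order S) A)"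

definition semisimple :: "('a, 'm) semigrp_scheme \<Rightarrow> bool" where
  "semisimple S \<longleftrightarrow> (\<forall>a \<in> carrier S. finite (order_ideal (natural_order S) a))"


section \<open>Boolean inverse semigroups\<close>

locale distributive_inverse_semigroup = inverse_semigroup +
  assumes zero_exists: "\<exists>z. is_zero S z"
    and join_exists:
      "\<lbrakk>a \<in> carrier S; b \<in> carrier S; compatible S a b\<rbrakk> \<Longrightarrow> \<exists>s. is_join S s {a, b}"
    and join_distrib_left:
      "\<lbrakk>a \<in> carrier S; b \<in> carrier S; compatible S a b; is_join S s {a, b}; c \<in> carrier S\<rbrakk>
        \<Longrightarrow> is_join S (c \<cdot> s) {c \<cdot> a, c \<cdot> b}"
    and join_distrib_right:
      "\<lbrakk>a \<in> carrier S; b \<in> carrier S; compatible S a b; is_join S s {a, b}; c \<in> carrier S\<rbrakk>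
        \<Longrightarrow> is_join S (s \<cdot> c) {a \<cdot> c, b \<cdot> c}"

locale boolean_inverse_semigroup = distributive_inverse_semigroup +
  assumes idempotents_boolean:
      "generalized_boolean_algebra ((natural_order S)\<lparr>carrier := idempotents S\<rparr>)"
    and nonzero: "carrier S \<noteq> {szero S}"


section \<open>Constructions\<close>

definition adjoin_zero :: "('g, 'm) monoid_scheme \<Rightarrow> 'g option semigrp" where
  "adjoin_zero G =
    \<lparr>carrier = insert None (Some ` carrier G),
     sprod = (\<lambda>a b. case (a, b) of (Some g, Some h) \<Rightarrow> Some (g \<otimes>\<^bsub>G\<^esub> h) | _ \<Rightarrow> None)\<rparr>"

text \<open>A matrix with rows and columns indexed by \<open>X\<close> is a function on pairs (row, column),
  \<open>undefined\<close> outside \<open>X \<times> X\<close>. For finite \<open>X\<close> the finiteness condition on the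
  non-zero entries is vacuous.\<close>

definition rook_matrix_set :: "'x set \<Rightarrow> ('a, 'm) semigrp_scheme \<Rightarrow> ('x \<times> 'x \<Rightarrow> 'a) set" where
  "rook_matrix_set X S =
    {A \<in> X \<times> X \<rightarrow>\<^sub>E carrier S.
      (\<forall>i \<in> X. \<forall>j \<in> X. \<forall>k \<in> X. j \<noteq> k \<longrightarrow> sinv S (A (i, j)) \<cdot>\<^bsub>S\<^esub> A (i, k) = szero S) \<and>
      (\<forall>i \<in> X. \<forall>j \<in> X. \<forall>k \<in> X. i \<noteq> k \<longrightarrow> A (i, j) \<cdot>\<^bsub>S\<^esub> sinv S (A (k, j)) = szero S) \<and>
      finite {p \<in> X \<times> X. A p \<noteq> szero S}}"

text \<open>The join in the product of two rook matrices is taken in the natural partial order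
  of \<open>S\<close>. The joined elements are pairwise orthogonal, and only finitely many of them
  are non-zero.\<close>

definition rook_matrices :: "'x set \<Rightarrow> ('a, 'm) semigrp_scheme \<Rightarrow> ('x \<times> 'x \<Rightarrow> 'a) semigrp" where
  "rook_matrices X S =
    \<lparr>carrier = rook_matrix_set X S,
     sprod = (\<lambda>A B. \<lambda>(i, j) \<in> X \<times> X.
       \<Squnion>\<^bsub>natural_order S\<^esub> ((\<lambda>k. A (i, k) \<cdot>\<^bsub>S\<^esub> B (k, j)) ` X))\<rparr>"

definition direct_product :: "'i set \<Rightarrow> ('i \<Rightarrow> ('a, 'm) semigrp_scheme) \<Rightarrow> ('i \<Rightarrow> 'a) semigrp" where
  "direct_product I S =
    \<lparr>carrier = (\<Pi>\<^sub>E i\<in>I. carrier (S i)),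
     sprod = (\<lambda>f g. \<lambda>i\<in>I. f i \<cdot>\<^bsub>S i\<^esub> g i)\<rparr>"

definition restricted_direct_product ::
    "'i set \<Rightarrow> ('i \<Rightarrow> ('a, 'm) semigrp_scheme) \<Rightarrow> ('i \<Rightarrow> 'a) semigrp" where
  "restricted_direct_product I S =
    (direct_product I S)
      \<lparr>carrier := {f \<in> carrier (direct_product I S). finite {i \<in> I. f i \<noteq> szero (S i)}}\<rparr>"

definition isomorphic :: "('a, 'm) semigrp_scheme \<Rightarrow> ('b, 'n) semigrp_scheme \<Rightarrow> bool" where
  "isomorphic S T \<longleftrightarrow>
    (\<exists>h. bij_betw h (carrier S) (carrier T) \<and>
      (\<forall>a \<in> carrier S. \<forall>b \<in> carrier S. h (a \<cdot>\<^bsub>S\<^esub> b) = h a \<cdot>\<^bsub>T\<^esub> h b))"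

end

theory Submission
  imports Defs
begin

text \<open>Let \<open>S\<close> be a semisimple Boolean inverse semigroup. An idempotent \<open>e \<noteq> 0\<close> is an atom if only \<open>0\<close>
  and \<open>e\<close> lie below it. Two atoms are connected if some \<open>a\<close> has \<open>a\<inverse>a\<close> equal to one and \<open>aa\<inverse>\<close> equal to the
  other, that is, if they are \<open>\<D>\<close>-related. The blocks of the decomposition are the classes of connected
  atoms. From each class choose a representative \<open>i\<close>, let \<open>X\<^sub>i\<close> be the class, let \<open>G\<^sub>i\<close> be the
  maximal subgroup at \<open>i\<close>, and for each \<open>e \<in> X\<^sub>i\<close> choose a link \<open>l\<^sub>e\<close> with domain \<open>i\<close> and range \<open>e\<close>.
  The isomorphism sends \<open>s\<close> to the family of matrices whose \<open>(e, f)\<close>-entry is \<open>l\<^sub>e\<inverse> s l\<^sub>f\<close>. Such an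
  entry is a translate of the corner \<open>esf\<close>: either \<open>0\<close>, or an element of \<open>G\<^sub>i\<close>.

  Multiplicativity uses no joins. If \<open>es \<noteq> 0\<close>, then the domain of \<open>es\<close> is an atom \<open>f\<close>
  connected with \<open>e\<close>, and it is the only atom with \<open>esf \<noteq> 0\<close> (\<open>corner_row\<close>). So each row of the matrix
  of \<open>s\<close> has at most one non-zero entry, and inserting \<open>l\<^sub>f l\<^sub>f\<inverse> = f\<close> between \<open>s\<close> and \<open>t\<close> does
  not change \<open>est\<close> (\<open>component_mult\<close>). There are only finitely many non-zero entries, because distinct non-zero
  corners \<open>esf\<close> are distinct elements below \<open>s\<close>.

  Injectivity says that \<open>s\<close> is determined by its corners (\<open>nle_if_corners_eq\<close>). The join \<open>q \<le> s\<close> of the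
  finitely many elements \<open>a \<le> s\<close> with atomic domain equals \<open>s\<close>: otherwise the domain of \<open>q\<close> has a non-zero
  complement in the domain of \<open>s\<close>, by semisimplicity there is an atom \<open>e\<close> below this complement, and \<open>se\<close> is one of the
  joined elements, although \<open>qe = 0\<close>. For surjectivity, the entry \<open>g\<close> at \<open>(e, f)\<close> of a given family is
  turned into the element \<open>l\<^sub>e g l\<^sub>f\<inverse>\<close>. These finitely many elements are pairwise orthogonal, because
  distinct ones have distinct domains and distinct ranges, and their join has the given entries
  (\<open>decomposition_surj\<close>).

  That \<open>M\<^sub>X(G\<^sup>0)\<close> is itself a semisimple Boolean inverse semigroup is seen by passing from a
  matrix to the finite set of triples \<open>(i, j, g)\<close> with \<open>g\<close> a non-zero entry in position \<open>(i, j)\<close>. These sets are the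
  finite partial bijections of \<open>X\<close> with labels in \<open>G\<close>. The product becomes composition, the natural order inclusion, and
  the join of compatible elements union. The idempotents are the finite sets of triples \<open>(i, i, 1)\<close>, which are closed
  under union and difference and therefore form a generalized Boolean algebra.\<close>


section \<open>Inverse semigroups\<close>

context inverse_semigroup
begin

abbreviation inverse_of :: "'a \<Rightarrow> 'a" (\<open>\<iota>\<close>) where "\<iota> \<equiv> sinv S"

abbreviation E where "E \<equiv> idempotents S"

lemma sinv_is_sinv: "a \<in> carrier S \<Longrightarrow> is_sinv S a (\<iota> a)"
  unfolding sinv_def using ex1_inverse by (rule theI')

lemma sinv_closed [simp]: "a \<in> carrier S \<Longrightarrow> \<iota> a \<in> carrier S"
  using sinv_is_sinv unfolding is_sinv_def by blast

lemma mult_sinv_mult: "a \<in> carrier S \<Longrightarrow> a \<cdot> (\<iota> a \<cdot> a) = a"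
  using sinv_is_sinv[of a] sinv_closed[of a] unfolding is_sinv_def by (simp add: prod_assoc)

lemma sinv_mult_sinv: "a \<in> carrier S \<Longrightarrow> \<iota> a \<cdot> (a \<cdot> \<iota> a) = \<iota> a"
  using sinv_is_sinv[of a] sinv_closed[of a] unfolding is_sinv_def by (simp add: prod_assoc)

lemma mult_sinv_mult_left [simp]:
  "\<lbrakk>a \<in> carrier S; x \<in> carrier S\<rbrakk> \<Longrightarrow> a \<cdot> (\<iota> a \<cdot> (a \<cdot> x)) = a \<cdot> x"
  by (metis mult_sinv_mult prod_assoc prod_closed sinv_closed)

lemma sinv_mult_sinv_left [simp]:
  "\<lbrakk>a \<in> carrier S; x \<in> carrier S\<rbrakk> \<Longrightarrow> \<iota> a \<cdot> (a \<cdot> (\<iota> a \<cdot> x)) = \<iota> a \<cdot> x"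
  by (metis sinv_mult_sinv prod_assoc prod_closed sinv_closed)

lemmas [simp] = prod_closed prod_assoc mult_sinv_mult sinv_mult_sinv

lemma sinv_eqI:
  assumes "a \<in> carrier S" "b \<in> carrier S" "a \<cdot> (b \<cdot> a) = a" "b \<cdot> (a \<cdot> b) = b"
  shows "\<iota> a = b"
proof -
  have "is_sinv S a b" using assms by (simp add: is_sinv_def)
  then show ?thesis using ex1_inverse[of a] sinv_is_sinv[of a] assms(1) by blast
qed

lemma sinv_sinv [simp]: "a \<in> carrier S \<Longrightarrow> \<iota> (\<iota> a) = a"
  by (rule sinv_eqI) auto

lemma idemI: "\<lbrakk>e \<in> carrier S; e \<cdot> e = e\<rbrakk> \<Longrightarrow> e \<in> E"
  by (simp add: idempotents_def)

lemma dom_idem [simp]: "a \<in> carrier S \<Longrightarrow> \<iota> a \<cdot> a \<in> E"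
  by (rule idemI) auto

lemma ran_idem [simp]: "a \<in> carrier S \<Longrightarrow> a \<cdot> \<iota> a \<in> E"
  by (rule idemI) auto

lemma idem_idem [simp]: "e \<in> E \<Longrightarrow> e \<cdot> e = e"
  unfolding idempotents_def by blast

lemma idem_carrier [simp]: "e \<in> E \<Longrightarrow> e \<in> carrier S"
  unfolding idempotents_def by blast

lemma idem_idem_left [simp]: "\<lbrakk>e \<in> E; x \<in> carrier S\<rbrakk> \<Longrightarrow> e \<cdot> (e \<cdot> x) = e \<cdot> x"
  by (subst prod_assoc[symmetric]) simp_all

lemma sinv_idem [simp]: "e \<in> E \<Longrightarrow> \<iota> e = e"
  by (rule sinv_eqI) auto

text \<open>If \<open>x\<close> is the inverse of \<open>e \<cdot> f\<close>, then \<open>f \<cdot> x \<cdot> e\<close> is another one. So they are equal, and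
  \<open>x\<close> is idempotent. As an idempotent is its own inverse, \<open>e \<cdot> f\<close> is \<open>x\<close>.\<close>

lemma idem_mult [simp]:
  assumes e: "e \<in> E" and f: "f \<in> E"
  shows "e \<cdot> f \<in> E"
proof -
  define x where "x = \<iota> (e \<cdot> f)"
  have x: "x \<in> carrier S" unfolding x_def using e f by simp
  have 1: "e \<cdot> (f \<cdot> (x \<cdot> (e \<cdot> f))) = e \<cdot> f"
    using mult_sinv_mult[of "e \<cdot> f"] e f x by (simp flip: x_def)
  have 2: "x \<cdot> (e \<cdot> (f \<cdot> x)) = x"
    using sinv_mult_sinv[of "e \<cdot> f"] e f x by (simp flip: x_def)
  have 3: "x \<cdot> (e \<cdot> (f \<cdot> (x \<cdot> y))) = x \<cdot> y" if "y \<in> carrier S" for y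
    using arg_cong[OF 2, of "\<lambda>z. z \<cdot> y"] e f x that by simp
  have 4: "\<iota> (e \<cdot> f) = f \<cdot> (x \<cdot> e)"
    by (rule sinv_eqI) (use e f x in \<open>simp_all add: 1 3\<close>)
  have "f \<cdot> (x \<cdot> e) \<cdot> (f \<cdot> (x \<cdot> e)) = f \<cdot> (x \<cdot> e)" using e f x by (simp add: 3)
  then have "x \<cdot> x = x" unfolding 4[folded x_def, symmetric] .
  then have "x \<in> E" using x by (intro idemI)
  moreover have "\<iota> x = e \<cdot> f" using sinv_sinv[OF prod_closed[of e f]] e f by (simp flip: x_def)
  ultimately have "e \<cdot> f = x" using sinv_idem[of x] by metis
  then show ?thesis using \<open>x \<in> E\<close> by simp
qed

lemma idem_commute:
  assumes e: "e \<in> E" and f: "f \<in> E"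
  shows "e \<cdot> f = f \<cdot> e"
proof -
  have ef: "e \<cdot> (f \<cdot> (e \<cdot> f)) = e \<cdot> f" and fe: "f \<cdot> (e \<cdot> (f \<cdot> e)) = f \<cdot> e"
    using idem_idem[OF idem_mult[OF e f]] idem_idem[OF idem_mult[OF f e]] e f
    by (simp_all del: idem_idem)
  have "\<iota> (e \<cdot> f) = f \<cdot> e"
    by (rule sinv_eqI) (use e f ef fe in simp_all)
  then show ?thesis using sinv_idem[OF idem_mult[OF e f]] by metis
qed

lemma idem_left_commute:
  "\<lbrakk>e \<in> E; f \<in> E; x \<in> carrier S\<rbrakk> \<Longrightarrow> e \<cdot> (f \<cdot> x) = f \<cdot> (e \<cdot> x)"
  by (metis idem_carrier idem_commute prod_assoc)

lemma sinv_mult [simp]: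
  assumes a: "a \<in> carrier S" and b: "b \<in> carrier S"
  shows "\<iota> (a \<cdot> b) = \<iota> b \<cdot> \<iota> a"
proof (rule sinv_eqI)
  have c: "b \<cdot> \<iota> b \<cdot> (\<iota> a \<cdot> a) = \<iota> a \<cdot> a \<cdot> (b \<cdot> \<iota> b)"
    using a b by (intro idem_commute) auto
  have "a \<cdot> b \<cdot> (\<iota> b \<cdot> \<iota> a \<cdot> (a \<cdot> b)) = a \<cdot> (b \<cdot> \<iota> b \<cdot> (\<iota> a \<cdot> a)) \<cdot> b" using a b by simp
  also have "\<dots> = a \<cdot> b" unfolding c using a b by simp
  finally show "a \<cdot> b \<cdot> (\<iota> b \<cdot> \<iota> a \<cdot> (a \<cdot> b)) = a \<cdot> b" .
  have "\<iota> b \<cdot> \<iota> a \<cdot> (a \<cdot> b \<cdot> (\<iota> b \<cdot> \<iota> a)) = \<iota> b \<cdot> (\<iota> a \<cdot> a \<cdot> (b \<cdot> \<iota> b)) \<cdot> \<iota> a" using a b by simp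
  also have "\<dots> = \<iota> b \<cdot> \<iota> a" unfolding c[symmetric] using a b by simp
  finally show "\<iota> b \<cdot> \<iota> a \<cdot> (a \<cdot> b \<cdot> (\<iota> b \<cdot> \<iota> a)) = \<iota> b \<cdot> \<iota> a" .
qed (use a b in auto)

lemma conj_idem:
  assumes a: "a \<in> carrier S" and e: "e \<in> E"
  shows "a \<cdot> (e \<cdot> \<iota> a) \<in> E"
proof (rule idemI)
  have "a \<cdot> (e \<cdot> \<iota> a) \<cdot> (a \<cdot> (e \<cdot> \<iota> a)) = a \<cdot> (e \<cdot> (\<iota> a \<cdot> a \<cdot> (e \<cdot> \<iota> a)))"
    using a e by simp
  also have "\<iota> a \<cdot> a \<cdot> (e \<cdot> \<iota> a) = e \<cdot> (\<iota> a \<cdot> a \<cdot> \<iota> a)"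
    using a e by (intro idem_left_commute) auto
  also have "a \<cdot> (e \<cdot> (e \<cdot> (\<iota> a \<cdot> a \<cdot> \<iota> a))) = a \<cdot> (e \<cdot> \<iota> a)"
    using a e by simp
  finally show "a \<cdot> (e \<cdot> \<iota> a) \<cdot> (a \<cdot> (e \<cdot> \<iota> a)) = a \<cdot> (e \<cdot> \<iota> a)" .
qed (use a e in simp)

lemma conj_idem' [simp]: "\<lbrakk>a \<in> carrier S; e \<in> E\<rbrakk> \<Longrightarrow> \<iota> a \<cdot> (e \<cdot> a) \<in> E"
  using conj_idem[of "\<iota> a" e] by simp

declare conj_idem [simp]


subsection \<open>The natural partial order\<close>

abbreviation nle (infix \<open>\<preceq>\<close> 50) where "a \<preceq> b \<equiv> le (natural_order S) a b"

lemma carrier_natural_order [simp]: "carrier (natural_order S) = carrier S"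
  by (simp add: natural_order_def)

lemma nle_iff: "\<lbrakk>a \<in> carrier S; b \<in> carrier S\<rbrakk> \<Longrightarrow> a \<preceq> b \<longleftrightarrow> a = b \<cdot> (\<iota> a \<cdot> a)"
  by (simp add: natural_order_def)

lemma nle_restrict: "\<lbrakk>b \<in> carrier S; e \<in> E\<rbrakk> \<Longrightarrow> b \<cdot> e \<preceq> b"
  using idem_left_commute[of e "\<iota> b \<cdot> b" e] by (simp add: nle_iff)

text \<open>A factor \<open>e\<close> on the left of \<open>b\<close> can be moved to the right as the idempotent
  \<open>\<iota> b \<cdot> (e \<cdot> b)\<close>.\<close>

lemma nle_corestrict:
  assumes "b \<in> carrier S" "e \<in> E"
  shows "e \<cdot> b \<preceq> b"
proof -
  have "b \<cdot> (\<iota> b \<cdot> (e \<cdot> b)) = e \<cdot> b"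
    using assms idem_left_commute[of "b \<cdot> \<iota> b" e b] by simp
  then show ?thesis using nle_restrict[of b "\<iota> b \<cdot> (e \<cdot> b)"] assms by simp
qed

text \<open>Besides \<open>a = b \<cdot> (\<iota> a \<cdot> a)\<close>, the relation \<open>a \<preceq> b\<close> also gives the left-handed equation: conjugating an
  idempotent by \<open>b\<close> moves it to the other side of \<open>b\<close>.\<close>

lemma nle_ran:
  assumes "a \<in> carrier S" "b \<in> carrier S" "a \<preceq> b"
  shows "a = a \<cdot> (\<iota> a \<cdot> b)"
proof -
  define e where "e = \<iota> a \<cdot> a"
  have e: "e \<in> E" "a = b \<cdot> e" using assms by (auto simp: e_def nle_iff)
  have "a \<cdot> (\<iota> a \<cdot> b) = b \<cdot> (e \<cdot> (\<iota> b \<cdot> b))" unfolding e(2) using e(1) assms(2) by simp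
  also have "\<dots> = b \<cdot> e" using idem_commute[of e "\<iota> b \<cdot> b"] e(1) assms(2) by simp
  finally show ?thesis using e by simp
qed

lemma nle_refl: "a \<in> carrier S \<Longrightarrow> a \<preceq> a"
  by (simp add: nle_iff)

lemma nle_antisym:
  assumes "a \<in> carrier S" "b \<in> carrier S" "a \<preceq> b" "b \<preceq> a"
  shows "a = b"
proof -
  have "b = a \<cdot> (\<iota> b \<cdot> b)" "a = b \<cdot> (\<iota> a \<cdot> a)" using assms by (auto simp: nle_iff)
  then have "b = b \<cdot> (\<iota> a \<cdot> a \<cdot> (\<iota> b \<cdot> b))" using assms by (metis dom_idem idem_carrier prod_assoc)
  also have "\<dots> = b \<cdot> (\<iota> a \<cdot> a)"
    using idem_commute[of "\<iota> a \<cdot> a" "\<iota> b \<cdot> b"] assms by simp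
  finally show ?thesis using \<open>a = b \<cdot> (\<iota> a \<cdot> a)\<close> by simp
qed

lemma nle_trans:
  assumes "a \<in> carrier S" "b \<in> carrier S" "c \<in> carrier S" "a \<preceq> b" "b \<preceq> c"
  shows "a \<preceq> c"
proof -
  have "a = b \<cdot> (\<iota> a \<cdot> a)" "b = c \<cdot> (\<iota> b \<cdot> b)" using assms by (auto simp: nle_iff)
  then have "a = c \<cdot> (\<iota> b \<cdot> b \<cdot> (\<iota> a \<cdot> a))" using assms by (metis dom_idem idem_carrier prod_assoc)
  then show ?thesis using nle_restrict[of c "\<iota> b \<cdot> b \<cdot> (\<iota> a \<cdot> a)"] assms by (metis dom_idem idem_mult)
qed

lemma nle_idem_iff: "\<lbrakk>e \<in> E; f \<in> E\<rbrakk> \<Longrightarrow> e \<preceq> f \<longleftrightarrow> f \<cdot> e = e"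
  using nle_iff[of e f] by auto

end


section \<open>Generalized Boolean algebras of sets\<close>

text \<open>A ring of sets, presented as an order whose elements are named by sets. Its lattice operations
  are pinned down by \<open>\<phi>\<close>, and each principal order-ideal is again of this kind, now with a greatest set.\<close>

locale represented_by_sets =
  fixes L :: "('a, 'b) gorder_scheme" (structure) and \<phi> :: "'a \<Rightarrow> 'c set"
  assumes eq_is_eq: "eq L = (=)"
    and le_iff: "\<lbrakk>x \<in> carrier L; y \<in> carrier L\<rbrakk> \<Longrightarrow> x \<sqsubseteq> y \<longleftrightarrow> \<phi> x \<subseteq> \<phi> y"
    and inj: "inj_on \<phi> (carrier L)"
    and union: "\<lbrakk>x \<in> carrier L; y \<in> carrier L\<rbrakk> \<Longrightarrow> \<exists>z \<in> carrier L. \<phi> z = \<phi> x \<union> \<phi> y"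
    and diff: "\<lbrakk>x \<in> carrier L; y \<in> carrier L\<rbrakk> \<Longrightarrow> \<exists>z \<in> carrier L. \<phi> z = \<phi> x - \<phi> y"
    and nonempty: "carrier L \<noteq> {}"
begin

lemma eqI: "\<lbrakk>x \<in> carrier L; y \<in> carrier L; \<phi> x = \<phi> y\<rbrakk> \<Longrightarrow> x = y"
  using inj by (rule inj_onD)

lemma empty: "\<exists>z \<in> carrier L. \<phi> z = {}"
  using diff nonempty by (metis Diff_cancel ex_in_conv)

lemma inter: "\<lbrakk>x \<in> carrier L; y \<in> carrier L\<rbrakk> \<Longrightarrow> \<exists>z \<in> carrier L. \<phi> z = \<phi> x \<inter> \<phi> y"
  using diff[of x] diff[of x y] by (metis Diff_Diff_Int)

lemma is_partial_order: "partial_order L"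
  by unfold_locales (use eqI in \<open>auto simp: le_iff eq_is_eq\<close>)

lemma least_iff:
  assumes "x \<in> carrier L" "y \<in> carrier L"
  shows "least L s (Upper L {x, y}) \<longleftrightarrow> s \<in> carrier L \<and> \<phi> s = \<phi> x \<union> \<phi> y"
proof -
  obtain z where z: "z \<in> carrier L" "\<phi> z = \<phi> x \<union> \<phi> y" using union[OF assms] by blast
  then have "least L z (Upper L {x, y})"
    using assms by (simp add: least_def Upper_def le_iff all_conj_distrib) (use assms le_iff in blast)
  moreover have "s = z" if "least L s (Upper L {x, y})" "least L z (Upper L {x, y})"
    using partial_order.least_unique[OF is_partial_order] that by blast
  ultimately show ?thesis using z eqI[of s z] by (metis least_closed)
qed

lemma greatest_iff:
  assumes "x \<in> carrier L" "y \<in> carrier L"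
  shows "greatest L s (Lower L {x, y}) \<longleftrightarrow> s \<in> carrier L \<and> \<phi> s = \<phi> x \<inter> \<phi> y"
proof -
  obtain z where z: "z \<in> carrier L" "\<phi> z = \<phi> x \<inter> \<phi> y" using inter[OF assms] by blast
  then have "greatest L z (Lower L {x, y})"
    using assms by (simp add: greatest_def Lower_def le_iff all_conj_distrib) (use assms le_iff in blast)
  moreover have "s = z" if "greatest L s (Lower L {x, y})" "greatest L z (Lower L {x, y})"
    using partial_order.greatest_unique[OF is_partial_order] that by blast
  ultimately show ?thesis using z eqI[of s z] by (metis greatest_closed)
qed

lemma join_eq:
  assumes "x \<in> carrier L" "y \<in> carrier L"
  shows "x \<squnion> y \<in> carrier L \<and> \<phi> (x \<squnion> y) = \<phi> x \<union> \<phi> y"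
  unfolding join_def sup_def least_iff[OF assms] using union[OF assms] by (rule someI2_bex) simp

lemma meet_eq:
  assumes "x \<in> carrier L" "y \<in> carrier L"
  shows "x \<sqinter> y \<in> carrier L \<and> \<phi> (x \<sqinter> y) = \<phi> x \<inter> \<phi> y"
  unfolding meet_def inf_def greatest_iff[OF assms] using inter[OF assms] by (rule someI2_bex) simp

lemma is_distributive_lattice: "distributive_lattice L"
proof -
  interpret partial_order L by (rule is_partial_order)
  show ?thesis
  proof
    fix x y assume "x \<in> carrier L" "y \<in> carrier L"
    then show "\<exists>s. least L s (Upper L {x, y})" "\<exists>s. greatest L s (Lower L {x, y})"
      using union[of x y] inter[of x y] by (auto simp: least_iff greatest_iff)
  next
    fix x y z assume "x \<in> carrier L" "y \<in> carrier L" "z \<in> carrier L"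
    then show "x \<sqinter> (y \<squnion> z) = (x \<sqinter> y) \<squnion> (x \<sqinter> z)"
      by (intro eqI) (simp_all add: join_eq meet_eq Int_Un_distrib)
  qed
qed

lemma least_carrier_iff: "least L z (carrier L) \<longleftrightarrow> z \<in> carrier L \<and> \<phi> z = {}"
proof
  assume "least L z (carrier L)"
  then have "z \<in> carrier L" "\<And>y. y \<in> carrier L \<Longrightarrow> \<phi> z \<subseteq> \<phi> y"
    unfolding least_def using le_iff by blast+
  then show "z \<in> carrier L \<and> \<phi> z = {}" using empty by blast
qed (simp add: least_def le_iff)

lemma bottom_eq: "\<bottom> \<in> carrier L \<and> \<phi> \<bottom> = {}"
  unfolding bottom_def least_carrier_iff using empty by (rule someI2_bex) simp

lemma has_bottom: "weak_partial_order_bottom L"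
proof -
  interpret partial_order L by (rule is_partial_order)
  show ?thesis by unfold_locales (use empty least_carrier_iff in blast)
qed

lemma is_unital_boolean_algebra:
  assumes t: "t \<in> carrier L" "\<And>x. x \<in> carrier L \<Longrightarrow> x \<sqsubseteq> t"
  shows "unital_boolean_algebra L"
proof -
  interpret distributive_lattice L by (rule is_distributive_lattice)
  interpret weak_partial_order_bottom L by (rule has_bottom)
  have "greatest L t (carrier L)" using t by (simp add: greatest_def)
  then have top: "\<top> = t"
    unfolding top_def by (intro some_equality) (use t greatest_unique in auto)
  show ?thesis
  proof
    show "\<exists>x. greatest L x (carrier L)" using \<open>greatest L t (carrier L)\<close> ..
    fix x assume x: "x \<in> carrier L"
    obtain y where y: "y \<in> carrier L" "\<phi> y = \<phi> t - \<phi> x" using diff t x by blast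
    have "\<phi> x \<subseteq> \<phi> t" using t x le_iff[of x t] by blast
    then have sets: "\<phi> x \<inter> (\<phi> t - \<phi> x) = {}" "\<phi> x \<union> (\<phi> t - \<phi> x) = \<phi> t" by auto
    have "x \<sqinter> y = \<bottom>"
      by (rule eqI) (use x y sets(1) bottom_eq meet_eq[of x y] in simp_all)
    moreover have "x \<squnion> y = \<top>"
      unfolding top by (rule eqI) (use x y sets(2) t(1) join_eq[of x y] in simp_all)
    ultimately show "\<exists>y\<in>carrier L. x \<sqinter> y = \<bottom> \<and> x \<squnion> y = \<top>" using y by blast
  qed
qed

lemma order_ideal_represented:
  assumes e: "e \<in> carrier L"
  shows "represented_by_sets (L\<lparr>carrier := order_ideal L e\<rparr>) \<phi>"
proof -
  have mem: "z \<in> order_ideal L e \<longleftrightarrow> z \<in> carrier L \<and> \<phi> z \<subseteq> \<phi> e" for z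
    using e by (auto simp: order_ideal_def le_iff)
  have "\<exists>z \<in> order_ideal L e. \<phi> z = \<phi> x \<union> \<phi> y" "\<exists>z \<in> order_ideal L e. \<phi> z = \<phi> x - \<phi> y"
    if xy: "x \<in> order_ideal L e" "y \<in> order_ideal L e" for x y
  proof -
    obtain z w where zw: "z \<in> carrier L" "\<phi> z = \<phi> x \<union> \<phi> y" "w \<in> carrier L" "\<phi> w = \<phi> x - \<phi> y"
      using xy union[of x y] diff[of x y] unfolding mem by blast
    have sub: "\<phi> x \<subseteq> \<phi> e" "\<phi> y \<subseteq> \<phi> e" using xy unfolding mem by blast+
    have "z \<in> order_ideal L e" unfolding mem zw(2) using zw(1) sub by blast
    moreover have "w \<in> order_ideal L e" unfolding mem zw(4) using zw(3) sub by blast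
    ultimately show "\<exists>z \<in> order_ideal L e. \<phi> z = \<phi> x \<union> \<phi> y"
      "\<exists>z \<in> order_ideal L e. \<phi> z = \<phi> x - \<phi> y"
      using zw(2,4) by blast+
  qed
  moreover have "order_ideal L e \<noteq> {}" using e unfolding order_ideal_def by (auto simp: le_iff)
  moreover have "x \<sqsubseteq> y \<longleftrightarrow> \<phi> x \<subseteq> \<phi> y" if "x \<in> order_ideal L e" "y \<in> order_ideal L e" for x y
    using that unfolding mem by (simp add: le_iff)
  moreover have "inj_on \<phi> (order_ideal L e)"
    using inj by (rule inj_on_subset) (simp add: order_ideal_def)
  ultimately show ?thesis
    by unfold_locales (simp_all add: eq_is_eq)
qed

theorem is_generalized_boolean_algebra: "generalized_boolean_algebra L"
proof (rule generalized_boolean_algebra.intro[OF is_distributive_lattice has_bottom],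
    rule generalized_boolean_algebra_axioms.intro)
  fix e assume e: "e \<in> carrier L"
  show "unital_boolean_algebra (L\<lparr>carrier := order_ideal L e\<rparr>)"
    by (rule represented_by_sets.is_unital_boolean_algebra[OF order_ideal_represented[OF e], of e])
      (use e in \<open>auto simp: order_ideal_def le_iff\<close>)
qed

end


section \<open>Rook matrices over a group with zero\<close>

locale rook_matrices_over_group = group G for G (structure) +
  fixes X :: "'x set"
begin

abbreviation G0 where "G0 \<equiv> adjoin_zero G"

lemma carrier_G0 [simp]: "carrier G0 = insert None (Some ` carrier G)"
  by (simp add: adjoin_zero_def)

lemma G0_mult [simp]:
  "None \<cdot>\<^bsub>G0\<^esub> b = None" "a \<cdot>\<^bsub>G0\<^esub> None = None" "Some g \<cdot>\<^bsub>G0\<^esub> Some h = Some (g \<otimes> h)"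
  by (simp_all add: adjoin_zero_def split: option.split)

lemma szero_G0 [simp]: "szero G0 = None"
  unfolding szero_def is_zero_def by (rule the_equality) (simp, metis G0_mult(1) carrier_G0 insertI1)

lemma sinv_G0_None [simp]: "sinv G0 None = None"
  unfolding sinv_def is_sinv_def by (rule the_equality) auto

lemma sinv_G0_Some [simp]: "g \<in> carrier G \<Longrightarrow> sinv G0 (Some g) = Some (inv g)"
  unfolding sinv_def is_sinv_def
  by (rule the_equality)
    (auto simp: m_assoc inv_solve_left inv_solve_right r_cancel_one intro!: inv_equality[symmetric])

lemma nle_G0:
  assumes "a \<in> carrier G0" "b \<in> carrier G0"
  shows "le (natural_order G0) a b \<longleftrightarrow> a = None \<or> a = b"
  using assms by (cases a; cases b) (auto simp: natural_order_def m_assoc)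

text \<open>The order on a group with zero is flat, so the joins that occur in a product of rook matrices are
  joins of sets with at most one non-zero element.\<close>

lemma sup_G0:
  assumes "A \<subseteq> carrier G0" "x \<in> A" "A \<subseteq> {None, x}"
  shows "\<Squnion>\<^bsub>natural_order G0\<^esub> A = x"
proof -
  have carr: "carrier (natural_order G0) = carrier G0" by (simp add: natural_order_def)
  have "x \<in> carrier G0" "None \<in> carrier G0" using assms by auto
  then have x: "x \<in> Upper (natural_order G0) A" and "least (natural_order G0) x (Upper (natural_order G0) A)"
    using assms nle_G0 unfolding least_def Upper_def carr by blast+
  moreover have "y = x" if "least (natural_order G0) y (Upper (natural_order G0) A)" for y
  proof -
    have "y \<in> carrier G0" "le (natural_order G0) x y" "le (natural_order G0) y x"
      using that assms x unfolding least_def Upper_def carr by auto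
    then show ?thesis using nle_G0 \<open>x \<in> carrier G0\<close> by blast
  qed
  ultimately show ?thesis unfolding sup_def by (intro some_equality)
qed


abbreviation M where "M \<equiv> rook_matrices X G0"

text \<open>A matrix takes an unspecified value outside \<open>X \<times> X\<close>, which may well be of the form
  \<open>Some g\<close>; hence the conditions on the indices.\<close>

definition entries :: "('x \<times> 'x \<Rightarrow> 'a option) \<Rightarrow> ('x \<times> 'x \<times> 'a) set" where
  "entries A = {(i, j, g). i \<in> X \<and> j \<in> X \<and> A (i, j) = Some g}"

text \<open>The graphs of the finite partial bijections of \<open>X\<close> with labels in \<open>G\<close>.\<close>

definition rook_relation :: "('x \<times> 'x \<times> 'a) set \<Rightarrow> bool" where
  "rook_relation R \<longleftrightarrow> finite R \<and> R \<subseteq> X \<times> X \<times> carrier G \<and>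
    (\<forall>i j k g h. (i, j, g) \<in> R \<longrightarrow> (i, k, h) \<in> R \<longrightarrow> j = k \<and> g = h) \<and>
    (\<forall>i j k g h. (i, j, g) \<in> R \<longrightarrow> (k, j, h) \<in> R \<longrightarrow> i = k \<and> g = h)"

definition rel_mult :: "('x \<times> 'x \<times> 'a) set \<Rightarrow> ('x \<times> 'x \<times> 'a) set \<Rightarrow> ('x \<times> 'x \<times> 'a) set" where
  "rel_mult R T = {(i, j, g). \<exists>k a b. (i, k, a) \<in> R \<and> (k, j, b) \<in> T \<and> g = a \<otimes> b}"

definition rel_inv :: "('x \<times> 'x \<times> 'a) set \<Rightarrow> ('x \<times> 'x \<times> 'a) set" where
  "rel_inv R = (\<lambda>(i, j, g). (j, i, inv g)) ` R"

lemma entries_iff: "(i, j, g) \<in> entries A \<longleftrightarrow> i \<in> X \<and> j \<in> X \<and> A (i, j) = Some g"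
  by (simp add: entries_def)

lemma rook_relation_carrier:
  assumes "rook_relation R" "(i, j, g) \<in> R"
  shows "i \<in> X" "j \<in> X" "g \<in> carrier G"
  using assms unfolding rook_relation_def by blast+

lemma rook_relation_row:
  assumes "rook_relation R" "(i, j, g) \<in> R" "(i, k, h) \<in> R"
  shows "k = j" "h = g"
  using assms unfolding rook_relation_def by blast+

lemma rook_relation_column:
  assumes "rook_relation R" "(i, j, g) \<in> R" "(k, j, h) \<in> R"
  shows "k = i" "h = g"
  using assms unfolding rook_relation_def by blast+

lemma finite_entries_iff: "finite (entries A) \<longleftrightarrow> finite {p \<in> X \<times> X. A p \<noteq> None}"
proof
  assume "finite (entries A)"
  moreover have "{p \<in> X \<times> X. A p \<noteq> None} \<subseteq> (\<lambda>(i, j, g). (i, j)) ` entries A"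
    by (auto simp: entries_def image_iff)
  ultimately show "finite {p \<in> X \<times> X. A p \<noteq> None}"
    using finite_surj by blast
next
  assume "finite {p \<in> X \<times> X. A p \<noteq> None}"
  moreover have "entries A \<subseteq> (\<lambda>(i, j). (i, j, the (A (i, j)))) ` {p \<in> X \<times> X. A p \<noteq> None}"
    by (force simp: entries_def image_iff)
  ultimately show "finite (entries A)"
    using finite_surj by blast
qed

text \<open>Over a group with zero, the products \<open>a\<inverse>b\<close> and \<open>ab\<inverse>\<close> vanish only if one of the
  factors does. So the rook conditions say that no row and no column has two non-zero entries.\<close>

lemma carrier_M_iff:
  "A \<in> carrier M \<longleftrightarrow> A \<in> extensional (X \<times> X) \<and> rook_relation (entries A)"
proof (cases "A \<in> X \<times> X \<rightarrow>\<^sub>E carrier G0")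
  case True
  have row: "sinv G0 (A (i, j)) \<cdot>\<^bsub>G0\<^esub> A (i, k) = None \<longleftrightarrow> A (i, j) = None \<or> A (i, k) = None"
    and column: "A (i, j) \<cdot>\<^bsub>G0\<^esub> sinv G0 (A (k, j)) = None \<longleftrightarrow> A (i, j) = None \<or> A (k, j) = None"
    if "i \<in> X" "j \<in> X" "k \<in> X" for i j k
  proof -
    have "A (i, j) \<in> carrier G0" "A (i, k) \<in> carrier G0" "A (k, j) \<in> carrier G0"
      using True that by (auto simp: PiE_def Pi_def simp del: carrier_G0)
    then show "sinv G0 (A (i, j)) \<cdot>\<^bsub>G0\<^esub> A (i, k) = None \<longleftrightarrow> A (i, j) = None \<or> A (i, k) = None"
      "A (i, j) \<cdot>\<^bsub>G0\<^esub> sinv G0 (A (k, j)) = None \<longleftrightarrow> A (i, j) = None \<or> A (k, j) = None"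
      by auto
  qed
  have "A \<in> carrier M \<longleftrightarrow>
      (\<forall>i \<in> X. \<forall>j \<in> X. \<forall>k \<in> X. j \<noteq> k \<longrightarrow> A (i, j) = None \<or> A (i, k) = None) \<and>
      (\<forall>i \<in> X. \<forall>j \<in> X. \<forall>k \<in> X. i \<noteq> k \<longrightarrow> A (i, j) = None \<or> A (k, j) = None) \<and>
      finite {p \<in> X \<times> X. A p \<noteq> None}"
    using True by (simp add: rook_matrices_def rook_matrix_set_def row column cong: ball_cong)
  also have "\<dots> \<longleftrightarrow> rook_relation (entries A)"
  proof -
    have entry: "(i, j, g) \<notin> entries A" if "i \<in> X \<Longrightarrow> j \<in> X \<Longrightarrow> A (i, j) = None" for i j g
      using that by (auto simp: entries_iff)
    have some: "\<exists>g. (i, j, g) \<in> entries A" if "i \<in> X" "j \<in> X" "A (i, j) \<noteq> None" for i j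
      using that by (auto simp: entries_iff)
    have same: "g = h" if "(i, j, g) \<in> entries A" "(i, j, h) \<in> entries A" for i j g h
      using that by (simp add: entries_iff)
    have index: "i \<in> X" "j \<in> X" if "(i, j, g) \<in> entries A" for i j g
      using that by (simp_all add: entries_iff)
    have "(\<forall>i \<in> X. \<forall>j \<in> X. \<forall>k \<in> X. j \<noteq> k \<longrightarrow> A (i, j) = None \<or> A (i, k) = None) \<longleftrightarrow>
      (\<forall>i j k g h. (i, j, g) \<in> entries A \<longrightarrow> (i, k, h) \<in> entries A \<longrightarrow> j = k \<and> g = h)"
      using entry some same index by metis
    moreover have "(\<forall>i \<in> X. \<forall>j \<in> X. \<forall>k \<in> X. i \<noteq> k \<longrightarrow> A (i, j) = None \<or> A (k, j) = None) \<longleftrightarrow>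
      (\<forall>i j k g h. (i, j, g) \<in> entries A \<longrightarrow> (k, j, h) \<in> entries A \<longrightarrow> i = k \<and> g = h)"
      using entry some same index by metis
    moreover have "entries A \<subseteq> X \<times> X \<times> carrier G"
      using True by (force simp: entries_iff PiE_def Pi_def)
    ultimately show ?thesis
      unfolding rook_relation_def finite_entries_iff by argo
  qed
  finally show ?thesis using True by (simp add: PiE_def)
next
  case False
  have "A \<in> X \<times> X \<rightarrow>\<^sub>E carrier G0" if "A \<in> extensional (X \<times> X)" "rook_relation (entries A)"
  proof (rule PiE_I)
    fix p assume "p \<in> X \<times> X"
    then show "A p \<in> carrier G0"
      using rook_relation_carrier(3)[OF that(2)] by (cases p; cases "A p") (auto simp: entries_iff)
  qed (use that(1) in \<open>auto simp: extensional_def\<close>)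
  then show ?thesis using False by (auto simp: rook_matrices_def rook_matrix_set_def)
qed

lemma entries_rook: "A \<in> carrier M \<Longrightarrow> rook_relation (entries A)"
  by (simp add: carrier_M_iff)

lemma entries_inj: "inj_on entries (extensional (X \<times> X))"
proof (rule inj_onI)
  fix A B assume ext: "A \<in> extensional (X \<times> X)" "B \<in> extensional (X \<times> X)" and eq: "entries A = entries B"
  have "A (i, j) = Some g \<longleftrightarrow> B (i, j) = Some g" if "i \<in> X" "j \<in> X" for i j g
    using eq that entries_iff[of i j g A] entries_iff[of i j g B] by simp
  then have "A p = B p" if "p \<in> X \<times> X" for p
    using that by (metis SigmaE not_None_eq)
  then show "A = B" by (rule extensionalityI[OF ext])
qed

lemma matrix_eqI: "\<lbrakk>A \<in> carrier M; B \<in> carrier M; entries A = entries B\<rbrakk> \<Longrightarrow> A = B"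
  using inj_onD[OF entries_inj] by (simp add: carrier_M_iff)

lemma ex_matrix:
  assumes R: "rook_relation R"
  shows "\<exists>A \<in> carrier M. entries A = R"
proof -
  define A where "A = (\<lambda>(i, j) \<in> X \<times> X. if \<exists>g. (i, j, g) \<in> R then Some (THE g. (i, j, g) \<in> R) else None)"
  have the: "(THE g. (i, j, g) \<in> R) = g" if "(i, j, g) \<in> R" for i j g
    using that rook_relation_row(2)[OF R that] by (rule the_equality)
  have "(i, j, g) \<in> entries A \<longleftrightarrow> (i, j, g) \<in> R" for i j g
    using the rook_relation_carrier[OF R] by (fastforce simp: entries_iff A_def split: if_splits)
  then have "entries A = R" by auto
  moreover have "A \<in> extensional (X \<times> X)" by (simp add: A_def)
  ultimately show ?thesis using R carrier_M_iff by blast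
qed

lemma rook_rel_mult:
  assumes R: "rook_relation R" and T: "rook_relation T"
  shows "rook_relation (rel_mult R T)"
proof -
  have "rel_mult R T \<subseteq> (\<lambda>((i, k, a), (k', j, b)). (i, j, a \<otimes> b)) ` (R \<times> T)"
    by (force simp: rel_mult_def image_iff)
  then have "finite (rel_mult R T)"
    using R T finite_surj by (metis finite_cartesian_product rook_relation_def)
  moreover have "rel_mult R T \<subseteq> X \<times> X \<times> carrier G"
    using rook_relation_carrier[OF R] rook_relation_carrier[OF T] by (auto simp: rel_mult_def)
  moreover have "j = k \<and> g = h" if rel: "(i, j, g) \<in> rel_mult R T" "(i, k, h) \<in> rel_mult R T" for i j k g h
  proof -
    obtain l a b l' c d where "(i, l, a) \<in> R" "(l, j, b) \<in> T" "g = a \<otimes> b"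
      "(i, l', c) \<in> R" "(l', k, d) \<in> T" "h = c \<otimes> d"
      using rel unfolding rel_mult_def by blast
    then show ?thesis using rook_relation_row[OF R] rook_relation_row[OF T] by metis
  qed
  moreover have "i = k \<and> g = h" if rel: "(i, j, g) \<in> rel_mult R T" "(k, j, h) \<in> rel_mult R T" for i j k g h
  proof -
    obtain l a b l' c d where "(i, l, a) \<in> R" "(l, j, b) \<in> T" "g = a \<otimes> b"
      "(k, l', c) \<in> R" "(l', j, d) \<in> T" "h = c \<otimes> d"
      using rel unfolding rel_mult_def by blast
    then show ?thesis using rook_relation_column[OF R] rook_relation_column[OF T] by metis
  qed
  ultimately show ?thesis unfolding rook_relation_def by blast
qed

lemma rel_inv_iff: 
  assumes "rook_relation R"
  shows "(i, j, g) \<in> rel_inv R \<longleftrightarrow> g \<in> carrier G \<and> (j, i, inv g) \<in> R"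
proof
  assume "(i, j, g) \<in> rel_inv R"
  then show "g \<in> carrier G \<and> (j, i, inv g) \<in> R"
    using rook_relation_carrier(3)[OF assms] by (auto simp: rel_inv_def)
next
  assume "g \<in> carrier G \<and> (j, i, inv g) \<in> R"
  then show "(i, j, g) \<in> rel_inv R" by (force simp: rel_inv_def image_iff)
qed

lemma rook_rel_inv:
  assumes R: "rook_relation R"
  shows "rook_relation (rel_inv R)"
proof -
  have "finite (rel_inv R)" "rel_inv R \<subseteq> X \<times> X \<times> carrier G"
    using R by (auto simp: rel_inv_def rook_relation_def)
  moreover have "j = k \<and> g = h" if "(i, j, g) \<in> rel_inv R" "(i, k, h) \<in> rel_inv R" for i j k g h
    using that rook_relation_column[OF R] rel_inv_iff[OF R] by (metis inv_inv)
  moreover have "i = k \<and> g = h" if "(i, j, g) \<in> rel_inv R" "(k, j, h) \<in> rel_inv R" for i j k g h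
    using that rook_relation_row[OF R] rel_inv_iff[OF R] by (metis inv_inv)
  ultimately show ?thesis unfolding rook_relation_def by blast
qed

text \<open>In a fixed row of \<open>A\<close> at most one entry is non-zero, so that the join which defines an entry
  of \<open>A \<cdot> B\<close> has at most one non-zero term.\<close>

lemma entries_mult:
  assumes A: "A \<in> carrier M" and B: "B \<in> carrier M"
  shows "entries (A \<cdot>\<^bsub>M\<^esub> B) = rel_mult (entries A) (entries B)"
proof -
  have G0: "A p \<in> carrier G0" "B p \<in> carrier G0" if "p \<in> X \<times> X" for p
    using A B that unfolding rook_matrices_def rook_matrix_set_def by (auto simp: PiE_def Pi_def simp del: carrier_G0)
  have "(i, j, g) \<in> entries (A \<cdot>\<^bsub>M\<^esub> B) \<longleftrightarrow> (i, j, g) \<in> rel_mult (entries A) (entries B)" for i j g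
  proof (cases "i \<in> X \<and> j \<in> X")
    case True
    define T where "T = (\<lambda>k. A (i, k) \<cdot>\<^bsub>G0\<^esub> B (k, j)) ` X"
    have AB: "(A \<cdot>\<^bsub>M\<^esub> B) (i, j) = \<Squnion>\<^bsub>natural_order G0\<^esub> T"
      using True by (simp add: rook_matrices_def T_def)
    have T0: "T \<subseteq> carrier G0"
    proof -
      have "A (i, k) \<cdot>\<^bsub>G0\<^esub> B (k, j) \<in> carrier G0" if "k \<in> X" for k
        using G0(1)[of "(i, k)"] G0(2)[of "(k, j)"] True that by auto
      then show ?thesis unfolding T_def by blast
    qed
    have T: "Some h \<in> T \<longleftrightarrow> (i, j, h) \<in> rel_mult (entries A) (entries B)" for h
    proof -
      have "A (i, k) \<cdot>\<^bsub>G0\<^esub> B (k, j) = Some h \<longleftrightarrow> (\<exists>a b. A (i, k) = Some a \<and> B (k, j) = Some b \<and> h = a \<otimes> b)" for k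
        by (cases "A (i, k)"; cases "B (k, j)") auto
      then have "Some h \<in> T \<longleftrightarrow> (\<exists>k\<in>X. \<exists>a b. A (i, k) = Some a \<and> B (k, j) = Some b \<and> h = a \<otimes> b)"
        unfolding T_def image_iff by metis
      then show ?thesis using True by (auto simp: rel_mult_def entries_iff)
    qed
    have rook: "rook_relation (rel_mult (entries A) (entries B))"
      using A B by (intro rook_rel_mult entries_rook)
    show ?thesis
    proof (cases "\<exists>h. Some h \<in> T")
      case True
      then obtain h where h: "Some h \<in> T" ..
      have "T \<subseteq> {None, Some h}"
      proof
        fix t assume "t \<in> T"
        then show "t \<in> {None, Some h}" using rook_relation_row(2)[OF rook] h T by (cases t) auto
      qed
      then have "(A \<cdot>\<^bsub>M\<^esub> B) (i, j) = Some h" using sup_G0[OF T0 h] AB by simp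
      then show ?thesis using h T rook_relation_row(2)[OF rook] \<open>i \<in> X \<and> j \<in> X\<close>
        by (auto simp: entries_iff)
    next
      case False
      then have sub: "T \<subseteq> {None, None}" by (metis insertI1 not_Some_eq subsetI)
      have "T \<noteq> {}" using \<open>i \<in> X \<and> j \<in> X\<close> by (auto simp: T_def)
      then have "None \<in> T" using sub by auto
      then have "(A \<cdot>\<^bsub>M\<^esub> B) (i, j) = None" using sup_G0[OF T0 _ sub] AB by simp
      then show ?thesis using False T by (auto simp: entries_iff)
    qed
  next
    case False
    then show ?thesis by (auto simp: rel_mult_def entries_iff)
  qed
  then show ?thesis by auto
qed

lemma mult_closed:
  assumes A: "A \<in> carrier M" and B: "B \<in> carrier M"
  shows "A \<cdot>\<^bsub>M\<^esub> B \<in> carrier M"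
proof -
  have "A \<cdot>\<^bsub>M\<^esub> B \<in> extensional (X \<times> X)" by (simp add: rook_matrices_def)
  then show ?thesis
    using A B by (simp add: carrier_M_iff entries_mult rook_rel_mult)
qed

lemma rel_mult_assoc:
  assumes "rook_relation R" "rook_relation T" "rook_relation U"
  shows "rel_mult (rel_mult R T) U = rel_mult R (rel_mult T U)"
proof -
  have "(i, j, g) \<in> rel_mult (rel_mult R T) U \<longleftrightarrow> (i, j, g) \<in> rel_mult R (rel_mult T U)" for i j g
  proof -
    have "(i, j, g) \<in> rel_mult (rel_mult R T) U \<longleftrightarrow>
      (\<exists>k l a b c. (i, k, a) \<in> R \<and> (k, l, b) \<in> T \<and> (l, j, c) \<in> U \<and> g = a \<otimes> b \<otimes> c)"
      unfolding rel_mult_def by (auto; blast)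
    also have "\<dots> \<longleftrightarrow>
      (\<exists>k l a b c. (i, k, a) \<in> R \<and> (k, l, b) \<in> T \<and> (l, j, c) \<in> U \<and> g = a \<otimes> (b \<otimes> c))"
      using assms[THEN rook_relation_carrier(3)] m_assoc by metis
    also have "\<dots> \<longleftrightarrow> (i, j, g) \<in> rel_mult R (rel_mult T U)"
      unfolding rel_mult_def by (auto; blast)
    finally show ?thesis .
  qed
  then show ?thesis by auto
qed


lemma rel_inv_inv: "rook_relation R \<Longrightarrow> rel_inv (rel_inv R) = R"
  using rook_relation_carrier(3)[of R] by (force simp: rel_inv_def image_iff)

text \<open>The relation \<open>R\<inverse>R\<close> is the identity, with label \<open>\<one>\<close>, on the columns that \<open>R\<close> uses; multiplying by it
  restricts \<open>T\<close> to these columns. With \<open>T = R\<close> this is the equation \<open>RR\<inverse>R = R\<close>, and in general it computes the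
  right-hand side of the definition of the natural order.\<close>

lemma rel_mult_inv_mult:
  assumes T: "rook_relation T" and R: "rook_relation R"
  shows "rel_mult (rel_mult T (rel_inv R)) R = {(i, j, g) \<in> T. \<exists>k h. (k, j, h) \<in> R}"
proof -
  have "(i, j, g) \<in> rel_mult (rel_mult T (rel_inv R)) R \<longleftrightarrow> (i, j, g) \<in> T \<and> (\<exists>k h. (k, j, h) \<in> R)"
    for i j g
  proof
    assume "(i, j, g) \<in> rel_mult (rel_mult T (rel_inv R)) R"
    then obtain k l a b c where *: "(i, k, a) \<in> T" "(k, l, b) \<in> rel_inv R" "(l, j, c) \<in> R"
      "g = a \<otimes> b \<otimes> c"
      unfolding rel_mult_def by blast
    then have b: "b \<in> carrier G" "(l, k, inv b) \<in> R" by (simp_all add: rel_inv_iff[OF R])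
    then have "j = k" "c = inv b" using rook_relation_row[OF R b(2) *(3)] by auto
    then show "(i, j, g) \<in> T \<and> (\<exists>k h. (k, j, h) \<in> R)"
      using * b rook_relation_carrier(3)[OF T *(1)] by (auto simp: m_assoc)
  next
    assume "(i, j, g) \<in> T \<and> (\<exists>k h. (k, j, h) \<in> R)"
    then obtain k h where *: "(i, j, g) \<in> T" "(k, j, h) \<in> R" by blast
    have c: "g \<in> carrier G" "h \<in> carrier G"
      using * rook_relation_carrier(3)[OF T] rook_relation_carrier(3)[OF R] by auto
    have "(j, k, inv h) \<in> rel_inv R" using * c by (simp add: rel_inv_iff[OF R])
    moreover have "g = g \<otimes> inv h \<otimes> h" using c by (simp add: m_assoc)
    ultimately show "(i, j, g) \<in> rel_mult (rel_mult T (rel_inv R)) R"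
      using * unfolding rel_mult_def by blast
  qed
  then show ?thesis by (simp add: set_eq_iff)
qed

text \<open>If \<open>RTR = R\<close>, a label \<open>h\<close> of \<open>R\<close> at \<open>(i, j)\<close> is a product of three labels. The outer two lie
  in row \<open>i\<close> and in column \<open>j\<close> of \<open>R\<close>, hence both are \<open>h\<close> itself, and the middle one is a label of \<open>T\<close> at
  \<open>(j, i)\<close>, which can only be \<open>inv h\<close>. Applied to \<open>T\<close> as well, this makes inverses unique.\<close>

lemma rel_inv_subset:
  assumes R: "rook_relation R" and T: "rook_relation T" and eq: "rel_mult (rel_mult R T) R = R"
  shows "rel_inv R \<subseteq> T"
proof clarify
  fix j i h assume "(j, i, h) \<in> rel_inv R"
  then have h: "h \<in> carrier G" "(i, j, inv h) \<in> R" by (simp_all add: rel_inv_iff[OF R])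
  then have "(i, j, inv h) \<in> rel_mult (rel_mult R T) R" using eq by simp
  then obtain k l a b c where *: "(i, k, a) \<in> R" "(k, l, b) \<in> T" "(l, j, c) \<in> R"
    "inv h = a \<otimes> b \<otimes> c"
    unfolding rel_mult_def by blast
  have kl: "k = j" "a = inv h" "l = i" "c = inv h"
    using rook_relation_row[OF R h(2) *(1)] rook_relation_column[OF R h(2) *(3)] .
  have b: "b \<in> carrier G" using rook_relation_carrier(3)[OF T *(2)] .
  have "inv h \<otimes> b \<otimes> inv h = inv h" using *(4) kl by simp
  then have "inv h \<otimes> b = \<one>" using h(1) b by (metis inv_closed m_closed r_cancel_one')
  then have "b = h" using h(1) b inv_equality by (metis inv_closed inv_comm inv_inv)
  then show "(j, i, h) \<in> T" using *(2) kl(1,3) by simp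
qed

lemma is_sinv_M_iff:
  assumes A: "A \<in> carrier M" and B: "B \<in> carrier M"
  shows "is_sinv M A B \<longleftrightarrow> entries B = rel_inv (entries A)"
proof
  have rook: "rook_relation (entries A)" "rook_relation (entries B)"
    using A B entries_rook by auto
  {
    assume "is_sinv M A B"
    then have "entries (A \<cdot>\<^bsub>M\<^esub> B \<cdot>\<^bsub>M\<^esub> A) = entries A" "entries (B \<cdot>\<^bsub>M\<^esub> A \<cdot>\<^bsub>M\<^esub> B) = entries B"
      by (simp_all add: is_sinv_def)
    then have "rel_inv (entries A) \<subseteq> entries B" "rel_inv (entries B) \<subseteq> entries A"
      using rel_inv_subset rook A B by (simp_all add: entries_mult mult_closed)
    moreover have "rel_inv (rel_inv (entries B)) \<subseteq> rel_inv (entries A)"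
      using calculation(2) unfolding rel_inv_def by blast
    ultimately show "entries B = rel_inv (entries A)"
      using rel_inv_inv[OF rook(2)] by blast
  }
  assume eq: "entries B = rel_inv (entries A)"
  have 1: "rel_mult (rel_mult R (rel_inv R)) R = R" if "rook_relation R" for R
    unfolding rel_mult_inv_mult[OF that that] by blast
  have "A \<cdot>\<^bsub>M\<^esub> B \<cdot>\<^bsub>M\<^esub> A = A"
    using A B 1[OF rook(1)] by (intro matrix_eqI) (auto simp: entries_mult mult_closed eq)
  moreover have "B \<cdot>\<^bsub>M\<^esub> A \<cdot>\<^bsub>M\<^esub> B = B"
    using A B 1[OF rook(2)]
    by (intro matrix_eqI) (auto simp: entries_mult mult_closed eq rel_inv_inv[OF rook(1)])
  ultimately show "is_sinv M A B" using B by (simp add: is_sinv_def)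
qed

lemma inverse_semigroup_M: "inverse_semigroup M"
proof
  fix A B C assume "A \<in> carrier M" "B \<in> carrier M" "C \<in> carrier M"
  then show "A \<cdot>\<^bsub>M\<^esub> B \<cdot>\<^bsub>M\<^esub> C = A \<cdot>\<^bsub>M\<^esub> (B \<cdot>\<^bsub>M\<^esub> C)"
    by (intro matrix_eqI) (simp_all add: entries_mult mult_closed rel_mult_assoc entries_rook)
next
  fix A assume A: "A \<in> carrier M"
  obtain B where B: "B \<in> carrier M" "entries B = rel_inv (entries A)"
    using ex_matrix rook_rel_inv entries_rook A by blast
  show "\<exists>!B. is_sinv M A B"
  proof
    show "is_sinv M A B" using A B is_sinv_M_iff by blast
    fix C assume C: "is_sinv M A C"
    then have "C \<in> carrier M" by (simp add: is_sinv_def)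
    then show "C = B" using A B C is_sinv_M_iff matrix_eqI by metis
  qed
qed (rule mult_closed)

interpretation Rook: inverse_semigroup M
  by (rule inverse_semigroup_M)

lemma entries_sinv: "A \<in> carrier M \<Longrightarrow> entries (sinv M A) = rel_inv (entries A)"
  using Rook.sinv_is_sinv[of A] Rook.sinv_closed[of A] is_sinv_M_iff by blast

lemma nle_M_iff:
  assumes A: "A \<in> carrier M" and B: "B \<in> carrier M"
  shows "le (natural_order M) A B \<longleftrightarrow> entries A \<subseteq> entries B"
proof -
  have rook: "rook_relation (entries A)" "rook_relation (entries B)"
    using A B entries_rook by auto
  have "le (natural_order M) A B \<longleftrightarrow> A = B \<cdot>\<^bsub>M\<^esub> sinv M A \<cdot>\<^bsub>M\<^esub> A"
    by (simp add: natural_order_def)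
  also have "\<dots> \<longleftrightarrow> entries A = entries (B \<cdot>\<^bsub>M\<^esub> sinv M A \<cdot>\<^bsub>M\<^esub> A)"
    using A B Rook.sinv_closed[OF A] mult_closed matrix_eqI by metis
  also have "entries (B \<cdot>\<^bsub>M\<^esub> sinv M A \<cdot>\<^bsub>M\<^esub> A) = {(i, j, g) \<in> entries B. \<exists>k h. (k, j, h) \<in> entries A}"
    using A B Rook.sinv_closed[OF A] rook
    by (simp add: entries_mult mult_closed entries_sinv rel_mult_inv_mult del: Rook.prod_assoc)
  also have "entries A = \<dots> \<longleftrightarrow> entries A \<subseteq> entries B"
  proof
    assume sub: "entries A \<subseteq> entries B"
    have "(i, j, g) \<in> entries A" if "(i, j, g) \<in> entries B" "(k, j, h) \<in> entries A" for i j g k h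
      using that sub rook_relation_column[OF rook(2) that(1), of k h] by blast
    then show "entries A = {(i, j, g) \<in> entries B. \<exists>k h. (k, j, h) \<in> entries A}" using sub by blast
  next
    assume eq: "entries A = {(i, j, g) \<in> entries B. \<exists>k h. (k, j, h) \<in> entries A}"
    show "entries A \<subseteq> entries B"
      by (rule subset_trans[OF equalityD1[OF eq]]) auto
  qed
  finally show ?thesis .
qed

text \<open>If \<open>A\<close> is idempotent, a non-zero entry \<open>g\<close> at \<open>(i, j)\<close> is the product of entries at \<open>(i, k)\<close> and
  \<open>(k, j)\<close>. The rook conditions force \<open>k = j\<close> and \<open>k = i\<close>, and both factors are \<open>g\<close>.\<close>

lemma idempotent_M_iff:
  "A \<in> idempotents M \<longleftrightarrow> A \<in> carrier M \<and> (\<forall>(i, j, g) \<in> entries A. i = j \<and> g = \<one>)"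
proof (cases "A \<in> carrier M")
  case True
  note rook = entries_rook[OF True]
  have "A \<in> idempotents M \<longleftrightarrow> rel_mult (entries A) (entries A) = entries A"
  proof -
    have "A \<in> idempotents M \<longleftrightarrow> A \<cdot>\<^bsub>M\<^esub> A = A" using True unfolding idempotents_def by blast
    also have "\<dots> \<longleftrightarrow> entries (A \<cdot>\<^bsub>M\<^esub> A) = entries A"
      using True mult_closed matrix_eqI by metis
    finally show ?thesis unfolding entries_mult[OF True True] .
  qed
  also have "\<dots> \<longleftrightarrow> (\<forall>(i, j, g) \<in> entries A. i = j \<and> g = \<one>)"
  proof
    assume idem: "rel_mult (entries A) (entries A) = entries A"
    show "\<forall>(i, j, g) \<in> entries A. i = j \<and> g = \<one>"
    proof clarify
      fix i j g assume ijg: "(i, j, g) \<in> entries A"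
      then have "(i, j, g) \<in> rel_mult (entries A) (entries A)" using idem by simp
      then obtain k a b where *: "(i, k, a) \<in> entries A" "(k, j, b) \<in> entries A" "g = a \<otimes> b"
        unfolding rel_mult_def by blast
      have kab: "k = j" "a = g" "k = i" "b = g"
        using rook_relation_row[OF rook ijg *(1)] rook_relation_column[OF rook ijg *(2)] .
      have "g \<otimes> g = g" using *(3) unfolding kab(2,4) by (rule sym)
      then show "i = j \<and> g = \<one>"
        using kab(1,3) rook_relation_carrier(3)[OF rook ijg] r_cancel_one by blast
    qed
  next
    assume diag: "\<forall>(i, j, g) \<in> entries A. i = j \<and> g = \<one>"
    have "(i, j, g) \<in> rel_mult (entries A) (entries A) \<longleftrightarrow> (i, j, g) \<in> entries A" for i j g
    proof
      assume "(i, j, g) \<in> rel_mult (entries A) (entries A)"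
      then obtain k a b where *: "(i, k, a) \<in> entries A" "(k, j, b) \<in> entries A" "g = a \<otimes> b"
        unfolding rel_mult_def by blast
      then have "a = \<one>" "k = j" "b = \<one>" using diag by auto
      then show "(i, j, g) \<in> entries A" using * by simp
    next
      assume ijg: "(i, j, g) \<in> entries A"
      then have "j = i" "g = \<one>" using diag by auto
      moreover have "\<one> = \<one> \<otimes> \<one>" by simp
      ultimately show "(i, j, g) \<in> rel_mult (entries A) (entries A)"
        using ijg unfolding rel_mult_def by blast
    qed
    then show "rel_mult (entries A) (entries A) = entries A" by auto
  qed
  finally show ?thesis using True by blast
qed (blast dest: Rook.idem_carrier)

text \<open>If entries \<open>g\<close> of \<open>A\<close> and \<open>h\<close> of \<open>B\<close> share a row, then \<open>inv g \<otimes> h\<close> is an entry of the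
  idempotent \<open>A\<inverse>B\<close>, so it is \<open>\<one>\<close> and lies on the diagonal: the two entries coincide. Likewise for a
  common column and \<open>AB\<inverse>\<close>. So the union of the entries is again a rook matrix, the join of \<open>A\<close> and \<open>B\<close>.\<close>

lemma compatible_M_rook:
  assumes A: "A \<in> carrier M" and B: "B \<in> carrier M" and comp: "compatible M A B"
  shows "rook_relation (entries A \<union> entries B)"
proof -
  note rA = entries_rook[OF A] and rB = entries_rook[OF B]
  have carr: "g \<in> carrier G" if "(i, j, g) \<in> entries A \<or> (i, j, g) \<in> entries B" for i j g
    using that rook_relation_carrier(3)[OF rA] rook_relation_carrier(3)[OF rB] by blast
  have row: "j = k \<and> g = h" if "(i, j, g) \<in> entries A" "(i, k, h) \<in> entries B" for i j k g h
  proof -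
    have gh: "g \<in> carrier G" "h \<in> carrier G" using that carr by blast+
    have "(j, i, inv g) \<in> rel_inv (entries A)" using that gh by (simp add: rel_inv_iff[OF rA])
    then have "(j, k, inv g \<otimes> h) \<in> entries (sinv M A \<cdot>\<^bsub>M\<^esub> B)"
      using that A B by (auto simp: entries_mult entries_sinv rel_mult_def)
    then have "j = k" "inv g \<otimes> h = \<one>"
      using comp idempotent_M_iff unfolding compatible_def by blast+
    then show ?thesis using gh by (metis inv_closed inv_equality inv_inv inv_comm)
  qed
  have column: "i = k \<and> g = h" if "(i, j, g) \<in> entries A" "(k, j, h) \<in> entries B" for i j k g h
  proof -
    have gh: "g \<in> carrier G" "h \<in> carrier G" using that carr by blast+
    have "(j, k, inv h) \<in> rel_inv (entries B)" using that gh by (simp add: rel_inv_iff[OF rB])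
    then have "(i, k, g \<otimes> inv h) \<in> entries (A \<cdot>\<^bsub>M\<^esub> sinv M B)"
      using that A B by (auto simp: entries_mult entries_sinv rel_mult_def)
    then have "i = k" "g \<otimes> inv h = \<one>"
      using comp idempotent_M_iff unfolding compatible_def by blast+
    then show ?thesis using gh by (metis inv_closed inv_equality inv_inv)
  qed
  have "j = k \<and> g = h" if "(i, j, g) \<in> entries A \<union> entries B" "(i, k, h) \<in> entries A \<union> entries B"
    for i j k g h
    using that row[of i j g k h] row[of i k h j g]
      rook_relation_row[OF rA, of i j g k h] rook_relation_row[OF rB, of i j g k h] by blast
  moreover have "i = k \<and> g = h" if "(i, j, g) \<in> entries A \<union> entries B" "(k, j, h) \<in> entries A \<union> entries B"
    for i j k g h
    using that column[of i j g k h] column[of k j h i g]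
      rook_relation_column[OF rA, of i j g k h] rook_relation_column[OF rB, of i j g k h] by blast
  moreover have "finite (entries A \<union> entries B)" "entries A \<union> entries B \<subseteq> X \<times> X \<times> carrier G"
    using rA rB by (simp_all add: rook_relation_def)
  ultimately show ?thesis unfolding rook_relation_def by blast
qed

lemma is_join_M:
  assumes "A \<in> carrier M" "B \<in> carrier M" "s \<in> carrier M" "entries s = entries A \<union> entries B"
  shows "is_join M s {A, B}"
  unfolding is_join_def
proof (rule least_UpperI)
  fix C assume "C \<in> Upper (natural_order M) {A, B}"
  then have "C \<in> carrier M" "le (natural_order M) A C" "le (natural_order M) B C"
    using assms(1,2) by (auto simp: Upper_def)
  then show "le (natural_order M) s C" using assms by (simp add: nle_M_iff)
qed (use assms in \<open>auto simp: nle_M_iff\<close>)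

lemma entries_join:
  assumes A: "A \<in> carrier M" and B: "B \<in> carrier M" and "compatible M A B" and s: "is_join M s {A, B}"
  shows "s \<in> carrier M \<and> entries s = entries A \<union> entries B"
proof -
  obtain t where t: "t \<in> carrier M" "entries t = entries A \<union> entries B"
    using ex_matrix compatible_M_rook assms by blast
  then have "is_join M t {A, B}" using is_join_M A B by blast
  then have "le (natural_order M) s t" "le (natural_order M) t s" "s \<in> carrier M"
    using s unfolding is_join_def least_def by auto
  then have "s = t" using Rook.nle_antisym t(1) by blast
  then show ?thesis using t by blast
qed

lemma ex_zero_M: "\<exists>Z \<in> carrier M. entries Z = {} \<and> is_zero M Z"
proof -
  obtain Z where Z: "Z \<in> carrier M" "entries Z = {}"
    using ex_matrix[of "{}"] by (auto simp: rook_relation_def)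
  have "Z \<cdot>\<^bsub>M\<^esub> A = Z" "A \<cdot>\<^bsub>M\<^esub> Z = Z" if "A \<in> carrier M" for A
    using that Z by (auto intro!: matrix_eqI simp: mult_closed entries_mult rel_mult_def)
  then show ?thesis using Z unfolding is_zero_def by blast
qed

lemma entries_szero_M: "szero M \<in> carrier M" "entries (szero M) = {}"
proof -
  obtain Z where Z: "Z \<in> carrier M" "entries Z = {}" "is_zero M Z" using ex_zero_M by blast
  then have "szero M = Z"
    unfolding szero_def by (intro the_equality) (auto simp: is_zero_def)
  then show "szero M \<in> carrier M" "entries (szero M) = {}" using Z by auto
qed

lemma rel_mult_Un:
  "rel_mult R (T \<union> U) = rel_mult R T \<union> rel_mult R U"
  "rel_mult (T \<union> U) R = rel_mult T R \<union> rel_mult U R"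
  unfolding rel_mult_def by blast+

lemma distributive_inverse_semigroup_M: "distributive_inverse_semigroup M"
proof
  show "\<exists>z. is_zero M z" using ex_zero_M by blast
next
  fix A B assume AB: "A \<in> carrier M" "B \<in> carrier M" "compatible M A B"
  obtain t where "t \<in> carrier M" "entries t = entries A \<union> entries B"
    using ex_matrix[OF compatible_M_rook[OF AB]] by blast
  then show "\<exists>s. is_join M s {A, B}" using is_join_M[OF AB(1,2)] by blast
  fix s C assume s: "is_join M s {A, B}" and C: "C \<in> carrier M"
  have s': "s \<in> carrier M" "entries s = entries A \<union> entries B" using entries_join[OF AB s] by auto
  show "is_join M (C \<cdot>\<^bsub>M\<^esub> s) {C \<cdot>\<^bsub>M\<^esub> A, C \<cdot>\<^bsub>M\<^esub> B}"
    by (rule is_join_M) (use AB C s' in \<open>simp_all add: mult_closed entries_mult rel_mult_Un\<close>)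
  show "is_join M (s \<cdot>\<^bsub>M\<^esub> C) {A \<cdot>\<^bsub>M\<^esub> C, B \<cdot>\<^bsub>M\<^esub> C}"
    by (rule is_join_M) (use AB C s' in \<open>simp_all add: mult_closed entries_mult rel_mult_Un\<close>)
qed

text \<open>Every set of entries that is contained in the entries of idempotents is diagonal with labels
  \<open>\<one>\<close>, hence the set of entries of an idempotent. This gives both union and difference.\<close>

lemma idempotents_M_represented:
  "represented_by_sets ((natural_order M)\<lparr>carrier := idempotents M\<rparr>) entries"
proof -
  have sub: "idempotents M \<subseteq> carrier M" using Rook.idem_carrier by blast
  have ex: "\<exists>C \<in> idempotents M. entries C = R"
    if AB: "A \<in> idempotents M" "B \<in> idempotents M" and R: "R \<subseteq> entries A \<union> entries B" for A B R
  proof -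
    have diag: "(i, j, g) \<in> R \<Longrightarrow> i = j \<and> g = \<one>" for i j g
      using AB R unfolding idempotent_M_iff by blast
    have "rook_relation (entries A)" "rook_relation (entries B)"
      using AB sub entries_rook by blast+
    then have "finite (entries A \<union> entries B)" "entries A \<union> entries B \<subseteq> X \<times> X \<times> carrier G"
      by (simp_all add: rook_relation_def)
    then have "finite R" "R \<subseteq> X \<times> X \<times> carrier G"
      using R finite_subset subset_trans by metis+
    then have "rook_relation R" using diag unfolding rook_relation_def by metis
    then obtain C where "C \<in> carrier M" "entries C = R" using ex_matrix by blast
    then show ?thesis using diag idempotent_M_iff[of C] by blast
  qed
  show ?thesis
  proof
    show "inj_on entries (carrier ((natural_order M)\<lparr>carrier := idempotents M\<rparr>))"
      using sub matrix_eqI by (auto intro!: inj_onI)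
    show "carrier ((natural_order M)\<lparr>carrier := idempotents M\<rparr>) \<noteq> {}"
      using entries_szero_M idempotent_M_iff[of "szero M"] by auto
  next
    fix A B
    assume A: "A \<in> carrier ((natural_order M)\<lparr>carrier := idempotents M\<rparr>)"
      and B: "B \<in> carrier ((natural_order M)\<lparr>carrier := idempotents M\<rparr>)"
    show "le ((natural_order M)\<lparr>carrier := idempotents M\<rparr>) A B \<longleftrightarrow> entries A \<subseteq> entries B"
      using A B sub nle_M_iff[of A B] by auto
    show "\<exists>C \<in> carrier ((natural_order M)\<lparr>carrier := idempotents M\<rparr>). entries C = entries A \<union> entries B"
      "\<exists>C \<in> carrier ((natural_order M)\<lparr>carrier := idempotents M\<rparr>). entries C = entries A - entries B"
      using A B ex[of A B "entries A \<union> entries B"] ex[of A B "entries A - entries B"] by auto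
  qed (simp add: natural_order_def)
qed

theorem boolean_inverse_semigroup_M:
  assumes "X \<noteq> {}"
  shows "boolean_inverse_semigroup M"
proof -
  obtain x where "x \<in> X" using assms by blast
  then have "rook_relation {(x, x, \<one>)}" by (auto simp: rook_relation_def)
  then obtain A where "A \<in> carrier M" "entries A = {(x, x, \<one>)}" using ex_matrix by blast
  then have "carrier M \<noteq> {szero M}" using entries_szero_M by auto
  then show ?thesis
    using distributive_inverse_semigroup_M
      represented_by_sets.is_generalized_boolean_algebra[OF idempotents_M_represented]
    by (intro boolean_inverse_semigroup.intro boolean_inverse_semigroup_axioms.intro)
qed

theorem semisimple_M: "semisimple M"
  unfolding semisimple_def
proof
  fix A assume A: "A \<in> carrier M"
  have sub: "order_ideal (natural_order M) A \<subseteq> carrier M" by (auto simp: order_ideal_def)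
  have "entries ` order_ideal (natural_order M) A \<subseteq> Pow (entries A)"
    using A sub nle_M_iff by (auto simp: order_ideal_def)
  moreover have "finite (entries A)" using entries_rook[OF A] by (simp add: rook_relation_def)
  ultimately have "finite (entries ` order_ideal (natural_order M) A)"
    by (meson finite_Pow_iff finite_subset)
  moreover have "inj_on entries (order_ideal (natural_order M) A)"
    by (rule inj_onI) (use sub in \<open>meson matrix_eqI subsetD\<close>)
  ultimately show "finite (order_ideal (natural_order M) A)" by (rule finite_imageD)
qed

end


section \<open>Orthogonal joins\<close>

context distributive_inverse_semigroup
begin

abbreviation zero :: 'a (\<open>\<zero>\<close>) where "\<zero> \<equiv> szero S"

lemma is_zero_zero: "is_zero S \<zero>"
proof -
  obtain z where z: "is_zero S z" using zero_exists by blast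
  have "szero S = z"
    unfolding szero_def
  proof (rule the_equality)
    show "w = z" if "is_zero S w" for w using that z unfolding is_zero_def by metis
  qed (rule z)
  then show ?thesis using z by simp
qed

lemma zero_closed [simp]: "\<zero> \<in> carrier S"
  using is_zero_zero by (simp add: is_zero_def)

lemma mult_zero [simp]: "a \<in> carrier S \<Longrightarrow> \<zero> \<cdot> a = \<zero>" "a \<in> carrier S \<Longrightarrow> a \<cdot> \<zero> = \<zero>"
  using is_zero_zero by (auto simp: is_zero_def)

lemma zero_idem [simp]: "\<zero> \<in> E"
  by (rule idemI) auto

lemma sinv_zero [simp]: "\<iota> \<zero> = \<zero>"
  by (rule sinv_idem) simp

lemma nle_zero: "a \<in> carrier S \<Longrightarrow> a \<preceq> \<zero> \<Longrightarrow> a = \<zero>"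
  using nle_iff[of a \<zero>] by simp

lemma is_joinD:
  assumes s: "is_join S s {a, b}" and ab: "a \<in> carrier S" "b \<in> carrier S"
  shows "s \<in> carrier S" "a \<preceq> s" "b \<preceq> s"
    and "\<lbrakk>u \<in> carrier S; a \<preceq> u; b \<preceq> u\<rbrakk> \<Longrightarrow> s \<preceq> u"
proof -
  have "s \<in> Upper (natural_order S) {a, b}" "\<forall>u \<in> Upper (natural_order S) {a, b}. s \<preceq> u"
    using s unfolding is_join_def least_def by blast+
  then show "s \<in> carrier S" "a \<preceq> s" "b \<preceq> s"
    "\<lbrakk>u \<in> carrier S; a \<preceq> u; b \<preceq> u\<rbrakk> \<Longrightarrow> s \<preceq> u"
    using ab unfolding Upper_def by auto
qed

lemma is_join_zero: "is_join S s {\<zero>, \<zero>} \<Longrightarrow> s = \<zero>"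
  using is_joinD(1)[of s \<zero> \<zero>] is_joinD(4)[of s \<zero> \<zero> \<zero>] nle_zero[of s] nle_refl[of \<zero>] by simp

text \<open>In the last two clauses multiplication is distributed over the join only where all terms vanish: an
  element that kills all members of \<open>A\<close> kills their join. These clauses make the induction work, because a further element \<open>a\<close>
  that is orthogonal to \<open>A\<close> is then orthogonal, hence compatible, to \<open>s\<close>.\<close>

lemma ex_orthogonal_join:
  assumes "finite A" "A \<subseteq> carrier S"
    and "\<And>a b. \<lbrakk>a \<in> A; b \<in> A; a \<noteq> b\<rbrakk> \<Longrightarrow> \<iota> a \<cdot> b = \<zero> \<and> a \<cdot> \<iota> b = \<zero>"
  shows "\<exists>s \<in> carrier S. (\<forall>a \<in> A. a \<preceq> s) \<and> (\<forall>u \<in> carrier S. (\<forall>a \<in> A. a \<preceq> u) \<longrightarrow> s \<preceq> u) \<and>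
    (\<forall>c \<in> carrier S. (\<forall>a \<in> A. c \<cdot> a = \<zero>) \<longrightarrow> c \<cdot> s = \<zero>) \<and>
    (\<forall>c \<in> carrier S. (\<forall>a \<in> A. a \<cdot> c = \<zero>) \<longrightarrow> s \<cdot> c = \<zero>)"
  using assms
proof (induction A rule: finite_induct)
  case empty
  then show ?case by (intro bexI[of _ \<zero>]) (auto simp: nle_iff)
next
  case (insert a A)
  have a: "a \<in> carrier S" and A: "A \<subseteq> carrier S" using insert.prems by auto
  have orth: "\<iota> a \<cdot> b = \<zero> \<and> b \<cdot> \<iota> a = \<zero>" if "b \<in> A" for b
  proof -
    have "a \<noteq> b" using that insert.hyps(2) by blast
    then show ?thesis using that insert.prems(2)[of a b] insert.prems(2)[of b a] by blast
  qed
  obtain s where s: "s \<in> carrier S" "\<And>b. b \<in> A \<Longrightarrow> b \<preceq> s"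
    "\<And>u. \<lbrakk>u \<in> carrier S; \<And>b. b \<in> A \<Longrightarrow> b \<preceq> u\<rbrakk> \<Longrightarrow> s \<preceq> u"
    "\<And>c. \<lbrakk>c \<in> carrier S; \<And>b. b \<in> A \<Longrightarrow> c \<cdot> b = \<zero>\<rbrakk> \<Longrightarrow> c \<cdot> s = \<zero>"
    "\<And>c. \<lbrakk>c \<in> carrier S; \<And>b. b \<in> A \<Longrightarrow> b \<cdot> c = \<zero>\<rbrakk> \<Longrightarrow> s \<cdot> c = \<zero>"
    using insert.IH[OF A insert.prems(2)] by auto
  have as: "\<iota> a \<cdot> s = \<zero>" "s \<cdot> \<iota> a = \<zero>"
    using s(4,5)[of "\<iota> a"] orth a by auto
  then have "\<iota> (s \<cdot> \<iota> a) = \<zero>" by simp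
  then have "a \<cdot> \<iota> s = \<zero>" using a s(1) by simp
  then have comp: "compatible S a s" using as unfolding compatible_def by simp
  then obtain t where t: "is_join S t {a, s}" using join_exists a s(1) by blast
  note tD = is_joinD[OF t a s(1)]
  have "c \<cdot> t = \<zero>" if c: "c \<in> carrier S" "\<And>b. b \<in> insert a A \<Longrightarrow> c \<cdot> b = \<zero>" for c
  proof -
    have "c \<cdot> a = \<zero>" "c \<cdot> s = \<zero>" using c s(4)[of c] by auto
    then show ?thesis using join_distrib_left[OF a s(1) comp t c(1)] is_join_zero by simp
  qed
  moreover have "t \<cdot> c = \<zero>" if c: "c \<in> carrier S" "\<And>b. b \<in> insert a A \<Longrightarrow> b \<cdot> c = \<zero>" for c
  proof -
    have "a \<cdot> c = \<zero>" "s \<cdot> c = \<zero>" using c s(5)[of c] by auto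
    then show ?thesis using join_distrib_right[OF a s(1) comp t c(1)] is_join_zero by simp
  qed
  moreover have "b \<preceq> t" if "b \<in> insert a A" for b
    using that tD(1,2,3) s(1) s(2)[of b] A nle_trans[of b s t] by auto
  moreover have "t \<preceq> u" if "u \<in> carrier S" "\<And>b. b \<in> insert a A \<Longrightarrow> b \<preceq> u" for u
    using that tD(4)[of u] s(3)[of u] by auto
  ultimately show ?case using tD(1) by (intro bexI[of _ t] conjI ballI impI) blast+
qed

end


section \<open>Atoms\<close>

locale semisimple_boolean_inverse_semigroup = boolean_inverse_semigroup S for S (structure) +
  assumes semisimple: "semisimple S"
begin

definition atoms where
  "atoms = {e \<in> E. e \<noteq> \<zero> \<and> (\<forall>f \<in> E. e \<cdot> f = f \<longrightarrow> f = \<zero> \<or> f = e)}"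

lemma atom_idem [simp]: "e \<in> atoms \<Longrightarrow> e \<in> E"
  unfolding atoms_def by blast

lemma atom_nonzero: "e \<in> atoms \<Longrightarrow> e \<noteq> \<zero>"
  unfolding atoms_def by blast

lemma atom_below: "\<lbrakk>e \<in> atoms; f \<in> E; e \<cdot> f = f; f \<noteq> \<zero>\<rbrakk> \<Longrightarrow> f = e"
  unfolding atoms_def by blast

lemma atoms_orthogonal:
  assumes "e \<in> atoms" "f \<in> atoms" "e \<cdot> f \<noteq> \<zero>"
  shows "e = f"
proof -
  have comm: "e \<cdot> f = f \<cdot> e" using assms by (intro idem_commute) auto
  have "e \<cdot> f = e" by (rule atom_below[OF assms(1)]) (use assms in simp_all)
  moreover have "f \<cdot> e = f"
    by (rule atom_below[OF assms(2)]) (use assms(1,2) assms(3)[unfolded comm] in simp_all)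
  ultimately show ?thesis using comm by metis
qed

lemma sinv_nonzero: "\<lbrakk>u \<in> carrier S; u \<noteq> \<zero>\<rbrakk> \<Longrightarrow> \<iota> u \<noteq> \<zero>"
  using sinv_sinv[of u] by force

lemma ran_nonzero: "\<lbrakk>u \<in> carrier S; u \<noteq> \<zero>\<rbrakk> \<Longrightarrow> u \<cdot> \<iota> u \<noteq> \<zero>"
  by (metis mult_zero(1) mult_sinv_mult prod_assoc sinv_closed)

lemma ran_eq_atom:
  assumes "e \<in> atoms" "u \<in> carrier S" "u \<noteq> \<zero>" "e \<cdot> u = u"
  shows "u \<cdot> \<iota> u = e"
proof (rule atom_below[OF assms(1)])
  show "e \<cdot> (u \<cdot> \<iota> u) = u \<cdot> \<iota> u"
    using assms by (metis atom_idem idem_carrier prod_assoc sinv_closed)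
qed (use assms ran_nonzero in simp_all)

lemma dom_eq_atom:
  assumes "e \<in> atoms" "u \<in> carrier S" "u \<noteq> \<zero>" "u \<cdot> e = u"
  shows "\<iota> u \<cdot> u = e"
proof -
  have "\<iota> (u \<cdot> e) = \<iota> u" using assms(4) by simp
  then have "e \<cdot> \<iota> u = \<iota> u" using assms(1,2) by simp
  then show ?thesis using ran_eq_atom[of e "\<iota> u"] assms sinv_nonzero by simp
qed

text \<open>Conjugation by \<open>u\<close> is an order isomorphism from the idempotents below \<open>\<iota> u \<cdot> u\<close> onto those
  below \<open>u \<cdot> \<iota> u\<close>.\<close>

lemma dom_atom:
  assumes u: "u \<in> carrier S" and atom: "u \<cdot> \<iota> u \<in> atoms"
  shows "\<iota> u \<cdot> u \<in> atoms"
  unfolding atoms_def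
proof (clarsimp simp: u, intro conjI ballI impI)
  show "\<iota> u \<cdot> u \<noteq> \<zero>"
  proof
    assume "\<iota> u \<cdot> u = \<zero>"
    then have "u = \<zero>" using mult_sinv_mult[OF u] u by simp
    then show False using atom_nonzero[OF atom] by simp
  qed
  fix g assume g: "g \<in> E" and below: "\<iota> u \<cdot> (u \<cdot> g) = g"
  have conj: "\<iota> u \<cdot> (u \<cdot> (g \<cdot> (\<iota> u \<cdot> u))) = g"
  proof -
    have "g \<cdot> (\<iota> u \<cdot> u) = \<iota> u \<cdot> u \<cdot> g" using g u by (intro idem_commute) auto
    also have "\<dots> = g" using below g u by simp
    finally show ?thesis using below by simp
  qed
  have "u \<cdot> (g \<cdot> \<iota> u) = \<zero> \<or> u \<cdot> (g \<cdot> \<iota> u) = u \<cdot> \<iota> u"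
    using atom_below[OF atom, of "u \<cdot> (g \<cdot> \<iota> u)"] g u by auto
  then show "g = \<zero> \<or> g = \<iota> u \<cdot> u"
  proof
    assume 0: "u \<cdot> (g \<cdot> \<iota> u) = \<zero>"
    have "g = \<iota> u \<cdot> (u \<cdot> (g \<cdot> \<iota> u) \<cdot> u)" using conj g u by simp
    then show ?thesis using 0 u by simp
  next
    assume 1: "u \<cdot> (g \<cdot> \<iota> u) = u \<cdot> \<iota> u"
    have "g = \<iota> u \<cdot> (u \<cdot> (g \<cdot> \<iota> u) \<cdot> u)" using conj g u by simp
    then show ?thesis using 1 u by simp
  qed
qed

text \<open>Distinct atoms are orthogonal, and \<open>u = u \<cdot> (\<iota> u \<cdot> u)\<close> has an atom as its domain; so every other
  atom is killed by \<open>u\<close>.\<close>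

lemma mult_atom:
  assumes u: "u \<in> carrier S" "u \<cdot> \<iota> u \<in> atoms" and e: "e \<in> atoms" "u \<cdot> e \<noteq> \<zero>"
  shows "e = \<iota> u \<cdot> u"
proof (rule ccontr)
  assume "e \<noteq> \<iota> u \<cdot> u"
  then have 0: "\<iota> u \<cdot> u \<cdot> e = \<zero>" using atoms_orthogonal dom_atom[OF u] e(1) by blast
  have "u \<cdot> e = u \<cdot> (\<iota> u \<cdot> u \<cdot> e)" using u(1) e(1) by simp
  then show False using 0 u(1) e(2) by simp
qed

lemma corner:
  assumes "e \<in> atoms" "f \<in> atoms" "s \<in> carrier S" "e \<cdot> (s \<cdot> f) \<noteq> \<zero>"
  shows "e \<cdot> (s \<cdot> f) \<cdot> \<iota> (e \<cdot> (s \<cdot> f)) = e" "\<iota> (e \<cdot> (s \<cdot> f)) \<cdot> (e \<cdot> (s \<cdot> f)) = f"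
  using ran_eq_atom[OF assms(1) _ assms(4)] dom_eq_atom[OF assms(2) _ assms(4)] assms(1-3)
  by (simp_all del: prod_assoc sinv_mult add: prod_assoc[of e "s \<cdot> f" f] prod_assoc[of s f f])

lemma corner_below: "\<lbrakk>e \<in> E; f \<in> E; s \<in> carrier S\<rbrakk> \<Longrightarrow> e \<cdot> (s \<cdot> f) \<preceq> s"
  using nle_trans[of "e \<cdot> (s \<cdot> f)" "s \<cdot> f" s] nle_corestrict[of "s \<cdot> f" e] nle_restrict[of s f] by simp

lemma finite_below: "s \<in> carrier S \<Longrightarrow> finite {a \<in> carrier S. a \<preceq> s}"
  using semisimple unfolding semisimple_def order_ideal_def by simp

text \<open>Induction on the number of elements below \<open>k\<close>, which is finite by semisimplicity.\<close>

lemma ex_atom_below: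
  "\<lbrakk>k \<in> E; k \<noteq> \<zero>\<rbrakk> \<Longrightarrow> \<exists>e \<in> atoms. k \<cdot> e = e"
proof (induction "card {a \<in> carrier S. a \<preceq> k}" arbitrary: k rule: less_induct)
  case less
  show ?case
  proof (cases "k \<in> atoms")
    case False
    then obtain f where f: "f \<in> E" "k \<cdot> f = f" "f \<noteq> \<zero>" "f \<noteq> k"
      using less.prems unfolding atoms_def by blast
    have fk: "f \<preceq> k" using f less.prems by (simp add: nle_idem_iff)
    then have "\<not> k \<preceq> f" using nle_antisym[of f k] f less.prems by auto
    moreover have "{a \<in> carrier S. a \<preceq> f} \<subseteq> {a \<in> carrier S. a \<preceq> k}"
      using fk nle_trans[of _ f k] f(1) less.prems(1) by auto
    ultimately have "{a \<in> carrier S. a \<preceq> f} \<subset> {a \<in> carrier S. a \<preceq> k}"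
      using nle_refl[of k] less.prems(1) idem_carrier by blast
    then have "card {a \<in> carrier S. a \<preceq> f} < card {a \<in> carrier S. a \<preceq> k}"
      using finite_below less.prems(1) by (intro psubset_card_mono) auto
    then obtain e where e: "e \<in> atoms" "f \<cdot> e = e" using less.hyps f by blast
    have "k \<cdot> e = k \<cdot> f \<cdot> e" using e f(1) less.prems(1) by simp
    then show ?thesis using e f(2) by auto
  qed (use less.prems in \<open>auto intro!: bexI[of _ k]\<close>)
qed

text \<open>The complement of \<open>d'\<close> in the unital Boolean algebra of the idempotents below \<open>d\<close>. Only two consequences
  of the lattice equations are extracted: the product vanishes because it lies below the meet, and the complement is not
  \<open>\<zero>\<close> because otherwise the join, which is \<open>d\<close>, would be \<open>d'\<close>.\<close>

lemma ex_relative_complement: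
  assumes d: "d \<in> E" "d' \<in> E" "d \<cdot> d' = d'" "d' \<noteq> d"
  shows "\<exists>k \<in> E. k \<noteq> \<zero> \<and> d \<cdot> k = k \<and> d' \<cdot> k = \<zero>"
proof -
  define L where "L = (natural_order S)\<lparr>carrier := E\<rparr>"
  define U where "U = L\<lparr>carrier := order_ideal L d\<rparr>"
  interpret U: unital_boolean_algebra U
    unfolding U_def L_def
    using generalized_boolean_algebra.order_ideal_boolean[OF idempotents_boolean] d(1) by simp
  have carr: "x \<in> carrier U \<longleftrightarrow> x \<in> E \<and> d \<cdot> x = x" for x
    using d(1) by (auto simp: U_def L_def order_ideal_def nle_idem_iff)
  have le: "le U x y \<longleftrightarrow> x \<preceq> y" for x y by (simp add: U_def L_def)
  have mem: "d \<in> carrier U" "d' \<in> carrier U" "\<zero> \<in> carrier U" using d by (auto simp: carr)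
  obtain y where y: "y \<in> carrier U" "d' \<sqinter>\<^bsub>U\<^esub> y = \<bottom>\<^bsub>U\<^esub>" "d' \<squnion>\<^bsub>U\<^esub> y = \<top>\<^bsub>U\<^esub>"
    using U.complement_exists[OF mem(2)] by blast
  have yE: "y \<in> E" "d \<cdot> y = y" using y(1) carr by auto
  have m: "d' \<cdot> y \<in> carrier U" using yE d idem_left_commute[of d d' y] by (simp add: carr)
  have "d' \<cdot> y \<preceq> d'" "d' \<cdot> y \<preceq> y"
    using yE(1) d(2) nle_restrict[of d' y] nle_corestrict[of y d'] by simp_all
  then have "le U (d' \<cdot> y) (d' \<sqinter>\<^bsub>U\<^esub> y)" using m mem y(1) by (intro U.meet_le) (auto simp: le)
  then have "d' \<cdot> y \<preceq> \<zero>"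
    using U.bottom_lower[OF mem(3)] U.le_trans[of "d' \<cdot> y" "\<bottom>\<^bsub>U\<^esub>" \<zero>] m mem y(2) by (simp add: le)
  then have "d' \<cdot> y = \<zero>" using nle_zero yE(1) d(2) by simp
  moreover have "y \<noteq> \<zero>"
  proof
    assume "y = \<zero>"
    then have "le U (d' \<squnion>\<^bsub>U\<^esub> y) d'"
      using mem d by (intro U.join_le) (auto simp: le nle_idem_iff)
    then have "le U d d'"
      using U.top_higher[OF mem(1)] U.le_trans[of d "\<top>\<^bsub>U\<^esub>" d'] mem y(3) by simp
    then show False using d idem_commute[of d d'] by (simp add: le nle_idem_iff)
  qed
  ultimately show ?thesis using yE by blast
qed

text \<open>The elements \<open>a \<preceq> s\<close> with atomic domain are corners of \<open>s\<close>, hence also corners of \<open>t\<close>, and so lie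
  below \<open>t\<close>. It remains to see that \<open>s\<close> is their join \<open>q\<close>. If the domain of \<open>q\<close> were smaller than that of
  \<open>s\<close>, an atom \<open>e\<close> below the relative complement would give an element \<open>s \<cdot> e\<close> that should lie below \<open>q\<close>
  although \<open>q\<close> kills \<open>e\<close>.\<close>

lemma nle_if_corners_eq:
  assumes s: "s \<in> carrier S" and t: "t \<in> carrier S"
    and corners: "\<And>e f. \<lbrakk>e \<in> atoms; f \<in> atoms\<rbrakk> \<Longrightarrow> e \<cdot> (s \<cdot> f) = e \<cdot> (t \<cdot> f)"
  shows "s \<preceq> t"
proof -
  define A where "A = {a \<in> carrier S. a \<preceq> s \<and> \<iota> a \<cdot> a \<in> atoms}"
  have A: "A \<subseteq> carrier S" "finite A"
    using finite_subset[OF _ finite_below[OF s], of A] by (auto simp: A_def)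
  have restrict: "a = s \<cdot> (\<iota> a \<cdot> a)" if "a \<in> A" for a
    using that s unfolding A_def by (simp flip: nle_iff)
  have at: "a \<preceq> t" if a: "a \<in> A" for a
  proof -
    have ac: "a \<in> carrier S" "a \<preceq> s" "\<iota> a \<cdot> a \<in> atoms" using a by (auto simp: A_def)
    have "a \<cdot> \<iota> a \<in> atoms" using dom_atom[of "\<iota> a"] ac by simp
    then have "a \<cdot> \<iota> a \<cdot> (t \<cdot> (\<iota> a \<cdot> a)) = a \<cdot> \<iota> a \<cdot> (s \<cdot> (\<iota> a \<cdot> a))"
      using corners ac(3) by simp
    also have "\<dots> = a" using restrict[OF a] ac(1) by simp
    finally have "a = a \<cdot> \<iota> a \<cdot> (t \<cdot> (\<iota> a \<cdot> a))" by simp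
    then show ?thesis using corner_below[of "a \<cdot> \<iota> a" "\<iota> a \<cdot> a" t] ac(1) t by simp
  qed
  have "\<iota> a \<cdot> b = \<zero> \<and> a \<cdot> \<iota> b = \<zero>" if ab: "a \<in> A" "b \<in> A" "a \<noteq> b" for a b
  proof -
    define e f where "e = \<iota> a \<cdot> a" and "f = \<iota> b \<cdot> b"
    have ef: "e \<in> atoms" "f \<in> atoms" "a = s \<cdot> e" "b = s \<cdot> f"
      using ab restrict unfolding e_def f_def A_def by auto
    then have 0: "e \<cdot> f = \<zero>" using atoms_orthogonal ab(3) by blast
    have "\<iota> a \<cdot> b = \<iota> s \<cdot> s \<cdot> (e \<cdot> f)"
      using ef(1,2) s idem_left_commute[of e "\<iota> s \<cdot> s" f] unfolding ef(3,4) by simp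
    moreover have "a \<cdot> \<iota> b = s \<cdot> (e \<cdot> f) \<cdot> \<iota> s"
      using ef(1,2) s unfolding ef(3,4) by simp
    ultimately show ?thesis using 0 s by simp
  qed
  then obtain q where q: "q \<in> carrier S" "\<And>a. a \<in> A \<Longrightarrow> a \<preceq> q"
    "\<And>u. \<lbrakk>u \<in> carrier S; \<And>a. a \<in> A \<Longrightarrow> a \<preceq> u\<rbrakk> \<Longrightarrow> q \<preceq> u"
    using ex_orthogonal_join[OF A(2,1)] by metis
  have qs: "q \<preceq> s" using q(3)[OF s] by (simp add: A_def)
  define d d' where "d = \<iota> s \<cdot> s" and "d' = \<iota> q \<cdot> q"
  have dE: "d \<in> E" "d' \<in> E" using s q(1) by (simp_all add: d_def d'_def)
  have q_eq: "q = s \<cdot> d'" using qs s q(1) by (simp add: nle_iff d'_def)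
  have "d \<cdot> d' = d'"
  proof -
    have "d' = \<iota> (s \<cdot> d') \<cdot> (s \<cdot> d')" using q_eq by (simp add: d'_def)
    also have "\<dots> = d' \<cdot> (d \<cdot> d')" using s dE(2) by (simp add: d_def)
    also have "\<dots> = d \<cdot> d'" using dE idem_left_commute[of d' d d'] by simp
    finally show ?thesis by simp
  qed
  have "d' = d"
  proof (rule ccontr)
    assume "d' \<noteq> d"
    then obtain k where k: "k \<in> E" "k \<noteq> \<zero>" "d \<cdot> k = k" "d' \<cdot> k = \<zero>"
      using ex_relative_complement dE \<open>d \<cdot> d' = d'\<close> by blast
    then obtain e where e: "e \<in> atoms" "k \<cdot> e = e" using ex_atom_below by blast
    have de: "d \<cdot> e = e"
      using k(1,3) e dE(1) prod_assoc[of d k e] by simp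
    have "\<iota> (s \<cdot> e) \<cdot> (s \<cdot> e) = e \<cdot> (d \<cdot> e)" using s e(1) by (simp add: d_def)
    then have dom: "\<iota> (s \<cdot> e) \<cdot> (s \<cdot> e) = e" using de e(1) by simp
    then have "s \<cdot> e \<in> A" using s e(1) nle_restrict[of s e] unfolding A_def by simp
    then have "s \<cdot> e = q \<cdot> e" using q(2)[of "s \<cdot> e"] q(1) s e(1) nle_iff[of "s \<cdot> e" q] dom by simp
    also have "\<dots> = s \<cdot> (d' \<cdot> k \<cdot> e)"
      using q_eq e dE(2) k(1) s by simp
    also have "\<dots> = \<zero>" using k(4) e(1) s by simp
    finally show False using dom atom_nonzero[OF e(1)] by simp
  qed
  then have "q = s" using q_eq s by (simp add: d_def)
  then show ?thesis using q(3)[OF t] at by blast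
qed

end


section \<open>The maximal subgroup of an idempotent\<close>

definition (in inverse_semigroup) maximal_subgroup :: "'a \<Rightarrow> 'a monoid" where
  "maximal_subgroup e =
    \<lparr>carrier = {a \<in> carrier S. a \<cdot> \<iota> a = e \<and> \<iota> a \<cdot> a = e}, mult = (\<cdot>), one = e\<rparr>"

lemma (in inverse_semigroup) mem_maximal_subgroup:
  "a \<in> carrier (maximal_subgroup e) \<longleftrightarrow> a \<in> carrier S \<and> a \<cdot> \<iota> a = e \<and> \<iota> a \<cdot> a = e"
  by (simp add: maximal_subgroup_def)

lemma (in inverse_semigroup) group_maximal_subgroup:
  assumes e: "e \<in> E"
  shows "group (maximal_subgroup e)"
proof (rule groupI)
  have mult: "mult (maximal_subgroup e) = (\<cdot>)" and one: "one (maximal_subgroup e) = e"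
    by (simp_all add: maximal_subgroup_def)
  note * = mult one mem_maximal_subgroup
  have unit: "e \<cdot> a = a" "a \<cdot> e = a" if "a \<in> carrier (maximal_subgroup e)" for a
  proof -
    have a: "a \<in> carrier S" "e = a \<cdot> \<iota> a" "e = \<iota> a \<cdot> a" using that by (simp_all add: *)
    show "e \<cdot> a = a" unfolding a(2) using a(1) by simp
    show "a \<cdot> e = a" unfolding a(3) using a(1) by simp
  qed
  show "a \<otimes>\<^bsub>maximal_subgroup e\<^esub> b \<in> carrier (maximal_subgroup e)"
    if ab: "a \<in> carrier (maximal_subgroup e)" "b \<in> carrier (maximal_subgroup e)" for a b
  proof -
    have a: "a \<in> carrier S" "a \<cdot> \<iota> a = e" "\<iota> a \<cdot> a = e"
      and b: "b \<in> carrier S" "b \<cdot> \<iota> b = e" "\<iota> b \<cdot> b = e"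
      using ab by (simp_all add: *)
    have "a \<cdot> b \<cdot> \<iota> (a \<cdot> b) = a \<cdot> (b \<cdot> \<iota> b) \<cdot> \<iota> a" using a(1) b(1) by simp
    also have "\<dots> = e" using unit(2)[OF ab(1)] a b(2) by simp
    finally have 1: "a \<cdot> b \<cdot> \<iota> (a \<cdot> b) = e" .
    have "\<iota> (a \<cdot> b) \<cdot> (a \<cdot> b) = \<iota> b \<cdot> (\<iota> a \<cdot> a \<cdot> b)" using a(1) b(1) by simp
    also have "\<dots> = e" using unit(1)[OF ab(2)] a(3) b by simp
    finally show ?thesis using 1 prod_closed[OF a(1) b(1)] unfolding * by blast
  qed
  show "\<exists>b \<in> carrier (maximal_subgroup e). b \<otimes>\<^bsub>maximal_subgroup e\<^esub> a = \<one>\<^bsub>maximal_subgroup e\<^esub>"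
    if "a \<in> carrier (maximal_subgroup e)" for a
    using that by (intro bexI[of _ "\<iota> a"]) (simp_all add: *)
qed (use e in \<open>simp_all add: maximal_subgroup_def\<close>, metis mult_sinv_mult prod_assoc sinv_closed)


section \<open>The classes of atoms and the coordinates of an element\<close>

context semisimple_boolean_inverse_semigroup
begin

definition connected :: "'a \<Rightarrow> 'a \<Rightarrow> bool" where
  "connected e f \<longleftrightarrow> (\<exists>a \<in> carrier S. \<iota> a \<cdot> a = e \<and> a \<cdot> \<iota> a = f)"

lemma connected_refl: "e \<in> E \<Longrightarrow> connected e e"
  unfolding connected_def by (intro bexI[of _ e]) simp_all

lemma connected_sym: "connected e f \<Longrightarrow> connected f e"
  unfolding connected_def by (metis sinv_closed sinv_sinv)

lemma connected_trans:
  assumes "connected e f" "connected f g"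
  shows "connected e g"
proof -
  obtain a b where a: "a \<in> carrier S" "\<iota> a \<cdot> a = e" "a \<cdot> \<iota> a = f"
    and b: "b \<in> carrier S" "\<iota> b \<cdot> b = f" "b \<cdot> \<iota> b = g"
    using assms unfolding connected_def by blast
  have "\<iota> (b \<cdot> a) \<cdot> (b \<cdot> a) = \<iota> a \<cdot> (\<iota> b \<cdot> b \<cdot> a)" using a(1) b(1) by simp
  also have "\<dots> = \<iota> a \<cdot> (a \<cdot> \<iota> a \<cdot> a)" unfolding a(3) b(2) ..
  also have "\<dots> = e" unfolding a(2)[symmetric] using a(1) by simp
  finally have 1: "\<iota> (b \<cdot> a) \<cdot> (b \<cdot> a) = e" .
  have "b \<cdot> a \<cdot> \<iota> (b \<cdot> a) = b \<cdot> (a \<cdot> \<iota> a \<cdot> \<iota> b)" using a(1) b(1) by simp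
  also have "\<dots> = b \<cdot> (\<iota> b \<cdot> b \<cdot> \<iota> b)" unfolding a(3) b(2) ..
  also have "\<dots> = g" unfolding b(3)[symmetric] using b(1) by simp
  finally show ?thesis using 1 a(1) b(1) unfolding connected_def by (metis prod_closed)
qed

text \<open>Connected atoms satisfy the same condition on \<open>f\<close>, so the choice depends only on the class.\<close>

definition rep :: "'a \<Rightarrow> 'a" where
  "rep e = (SOME f. f \<in> atoms \<and> connected f e)"

lemma rep_atom: "e \<in> atoms \<Longrightarrow> rep e \<in> atoms" and connected_rep: "e \<in> atoms \<Longrightarrow> connected (rep e) e"
  using someI[of "\<lambda>f. f \<in> atoms \<and> connected f e" e] connected_refl[of e]
  by (simp_all add: rep_def)

lemma rep_eqI: "connected e f \<Longrightarrow> rep e = rep f"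
  unfolding rep_def using connected_sym connected_trans by metis

definition link :: "'a \<Rightarrow> 'a" where
  "link e = (SOME a. a \<in> carrier S \<and> \<iota> a \<cdot> a = rep e \<and> a \<cdot> \<iota> a = e)"

lemma link:
  assumes "e \<in> atoms"
  shows "link e \<in> carrier S" "\<iota> (link e) \<cdot> link e = rep e" "link e \<cdot> \<iota> (link e) = e"
proof -
  have "\<exists>a. a \<in> carrier S \<and> \<iota> a \<cdot> a = rep e \<and> a \<cdot> \<iota> a = e"
    using connected_rep[OF assms] unfolding connected_def by blast
  then have "link e \<in> carrier S \<and> \<iota> (link e) \<cdot> link e = rep e \<and> link e \<cdot> \<iota> (link e) = e"
    unfolding link_def by (rule someI_ex)
  then show "link e \<in> carrier S" "\<iota> (link e) \<cdot> link e = rep e" "link e \<cdot> \<iota> (link e) = e" by auto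
qed

lemma link_left:
  assumes "e \<in> atoms" "x \<in> carrier S"
  shows "link e \<cdot> (\<iota> (link e) \<cdot> x) = e \<cdot> x" "\<iota> (link e) \<cdot> (link e \<cdot> x) = rep e \<cdot> x"
    "\<iota> (link e) \<cdot> (e \<cdot> x) = \<iota> (link e) \<cdot> x"
proof -
  note l = link[OF assms(1)]
  show "link e \<cdot> (\<iota> (link e) \<cdot> x) = e \<cdot> x"
    using prod_assoc[of "link e" "\<iota> (link e)" x] l assms(2) by simp
  then show "\<iota> (link e) \<cdot> (e \<cdot> x) = \<iota> (link e) \<cdot> x"
    using l(1) assms(2) sinv_mult_sinv_left by metis
  show "\<iota> (link e) \<cdot> (link e \<cdot> x) = rep e \<cdot> x"
    using prod_assoc[of "\<iota> (link e)" "link e" x] l assms(2) by simp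
qed

lemma link_right:
  assumes "e \<in> atoms"
  shows "e \<cdot> link e = link e" "\<iota> (link e) \<cdot> e = \<iota> (link e)" "link e \<cdot> rep e = link e"
    "rep e \<cdot> \<iota> (link e) = \<iota> (link e)"
  using link[OF assms] mult_sinv_mult[of "link e"] sinv_mult_sinv[of "link e"] 
    mult_sinv_mult_left sinv_mult_sinv_left
  by (metis prod_assoc sinv_closed)+

definition representatives :: "'a set" where
  "representatives = rep ` atoms"

definition atom_class :: "'a \<Rightarrow> 'a set" where
  "atom_class i = {e \<in> atoms. rep e = i}"

text \<open>The corner \<open>e \<cdot> (s \<cdot> f)\<close>, moved by the links from the atoms \<open>e\<close> and \<open>f\<close> to
  their representatives.\<close>

definition coord :: "'a \<Rightarrow> 'a \<Rightarrow> 'a \<Rightarrow> 'a" where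
  "coord s e f = \<iota> (link e) \<cdot> (s \<cdot> link f)"

lemma coord_closed: "\<lbrakk>s \<in> carrier S; e \<in> atoms; f \<in> atoms\<rbrakk> \<Longrightarrow> coord s e f \<in> carrier S"
  unfolding coord_def using link(1) by simp

lemma link_coord_link:
  assumes "s \<in> carrier S" "e \<in> atoms" "f \<in> atoms"
  shows "link e \<cdot> (coord s e f \<cdot> \<iota> (link f)) = e \<cdot> (s \<cdot> f)"
  using assms link(1,3) link_left(1) by (simp add: coord_def)

lemma coord_corner:
  assumes "s \<in> carrier S" "e \<in> atoms" "f \<in> atoms"
  shows "coord s e f = \<iota> (link e) \<cdot> (e \<cdot> (s \<cdot> f) \<cdot> link f)"
  using assms link(1) link_right(1) link_left(3) by (simp add: coord_def)

lemma coord_zero_iff: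
  assumes "s \<in> carrier S" "e \<in> atoms" "f \<in> atoms"
  shows "coord s e f = \<zero> \<longleftrightarrow> e \<cdot> (s \<cdot> f) = \<zero>"
  using link_coord_link[OF assms] coord_corner[OF assms] assms link(1)
  by (metis mult_zero sinv_closed)

text \<open>Multiplication by \<open>i\<close> fixes the coordinate on both sides, and \<open>i\<close> is an atom. So the range and the domain
  of a non-zero coordinate are \<open>i\<close>.\<close>

lemma coord_group:
  assumes s: "s \<in> carrier S" and e: "e \<in> atom_class i" and f: "f \<in> atom_class i" and nz: "coord s e f \<noteq> \<zero>"
  shows "coord s e f \<in> carrier (maximal_subgroup i)"
proof -
  have ef: "e \<in> atoms" "f \<in> atoms" "rep e = i" "rep f = i" using e f by (auto simp: atom_class_def)
  then have i: "i \<in> atoms" using rep_atom by blast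
  have c: "coord s e f \<in> carrier S" using coord_closed s ef by blast
  have le: "i \<cdot> \<iota> (link e) = \<iota> (link e)" and lf: "link f \<cdot> i = link f"
    using link_right ef by metis+
  have "i \<cdot> coord s e f = i \<cdot> \<iota> (link e) \<cdot> (s \<cdot> link f)"
    unfolding coord_def using s ef link(1) i by simp
  then have "i \<cdot> coord s e f = coord s e f" unfolding le by (simp add: coord_def)
  moreover have "coord s e f \<cdot> i = \<iota> (link e) \<cdot> (s \<cdot> (link f \<cdot> i))"
    unfolding coord_def using s ef(1,2) link(1) i by simp
  then have "coord s e f \<cdot> i = coord s e f" unfolding lf by (simp add: coord_def)
  ultimately show ?thesis
    using ran_eq_atom[OF i c nz] dom_eq_atom[OF i c nz] c by (simp add: mem_maximal_subgroup)
qed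

lemma corner_class:
  assumes "s \<in> carrier S" "e \<in> atoms" "f \<in> atoms" "e \<cdot> (s \<cdot> f) \<noteq> \<zero>"
  shows "rep e = rep f"
proof -
  have "connected f e"
    unfolding connected_def using corner[OF assms(2,3,1,4)] assms(1-3)
    by (intro bexI[of _ "e \<cdot> (s \<cdot> f)"]) simp_all
  then show ?thesis using rep_eqI by metis
qed

text \<open>A non-zero element \<open>e \<cdot> s\<close> has range \<open>e\<close>, so its domain is an atom, and this atom is the only one
  that \<open>e \<cdot> s\<close> does not kill.\<close>

lemma corner_row:
  assumes s: "s \<in> carrier S" and e: "e \<in> atoms" and f: "f \<in> atoms" and nz: "e \<cdot> (s \<cdot> f) \<noteq> \<zero>"
  shows "e \<cdot> (s \<cdot> f) = e \<cdot> s" "\<lbrakk>g \<in> atoms; e \<cdot> (s \<cdot> g) \<noteq> \<zero>\<rbrakk> \<Longrightarrow> g = f"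
proof -
  have es: "e \<cdot> s \<in> carrier S" "e \<cdot> s \<cdot> f \<noteq> \<zero>" using s e f nz by auto
  then have nz': "e \<cdot> s \<noteq> \<zero>" using f by auto
  have ran: "e \<cdot> s \<cdot> \<iota> (e \<cdot> s) \<in> atoms"
    using ran_eq_atom[OF e es(1) nz'] e s by (simp del: sinv_mult)
  have fd: "f = \<iota> (e \<cdot> s) \<cdot> (e \<cdot> s)" using mult_atom[OF es(1) ran f es(2)] .
  show "e \<cdot> (s \<cdot> f) = e \<cdot> s"
    using mult_sinv_mult[OF es(1)] unfolding fd[symmetric] using s e f by simp
  show "g = f" if g: "g \<in> atoms" "e \<cdot> (s \<cdot> g) \<noteq> \<zero>"
    using mult_atom[OF es(1) ran g(1)] g s e fd by simp
qed

lemma corner_column: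
  assumes s: "s \<in> carrier S" and e: "e \<in> atoms" and f: "f \<in> atoms" and nz: "e \<cdot> (s \<cdot> f) \<noteq> \<zero>"
    and g: "g \<in> atoms" "g \<cdot> (s \<cdot> f) \<noteq> \<zero>"
  shows "g = e"
proof -
  have "\<iota> (e \<cdot> (s \<cdot> f)) \<noteq> \<zero>" "\<iota> (g \<cdot> (s \<cdot> f)) \<noteq> \<zero>"
    using s e f g nz by (intro sinv_nonzero; simp)+
  then have "f \<cdot> (\<iota> s \<cdot> e) \<noteq> \<zero>" "f \<cdot> (\<iota> s \<cdot> g) \<noteq> \<zero>" using s e f g by simp_all
  then show ?thesis using corner_row(2)[of "\<iota> s" f e g] s e f g(1) by simp
qed

text \<open>The atom is the domain of \<open>e \<cdot> s\<close>.\<close>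

lemma ex_corner_column:
  assumes s: "s \<in> carrier S" and e: "e \<in> atoms" and nz: "e \<cdot> s \<noteq> \<zero>"
  shows "\<exists>f \<in> atoms. e \<cdot> (s \<cdot> f) = e \<cdot> s"
proof -
  have es: "e \<cdot> s \<in> carrier S" using s e by simp
  have "e \<cdot> s \<cdot> \<iota> (e \<cdot> s) \<in> atoms"
    using ran_eq_atom[OF e es nz] e s by (simp del: sinv_mult)
  then have "\<iota> (e \<cdot> s) \<cdot> (e \<cdot> s) \<in> atoms" using dom_atom[OF es] by simp
  moreover have "e \<cdot> s \<cdot> (\<iota> (e \<cdot> s) \<cdot> (e \<cdot> s)) = e \<cdot> s" using mult_sinv_mult[OF es] .
  ultimately show ?thesis using s e by (metis atom_idem idem_carrier prod_assoc)
qed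


section \<open>The decomposition\<close>

abbreviation block :: "'a \<Rightarrow> ('a \<times> 'a \<Rightarrow> 'a option) semigrp" where
  "block i \<equiv> rook_matrices (atom_class i) (adjoin_zero (maximal_subgroup i))"

abbreviation block_entries :: "'a \<Rightarrow> ('a \<times> 'a \<Rightarrow> 'a option) \<Rightarrow> ('a \<times> 'a \<times> 'a) set" where
  "block_entries i \<equiv> rook_matrices_over_group.entries (atom_class i)"

definition component :: "'a \<Rightarrow> 'a \<Rightarrow> ('a \<times> 'a \<Rightarrow> 'a option)" where
  "component s i = (\<lambda>(e, f) \<in> atom_class i \<times> atom_class i.
    if coord s e f = \<zero> then None else Some (coord s e f))"

definition decomposition :: "'a \<Rightarrow> ('a \<Rightarrow> 'a \<times> 'a \<Rightarrow> 'a option)" where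
  "decomposition s = (\<lambda>i \<in> representatives. component s i)"

lemma representative_atom: "i \<in> representatives \<Longrightarrow> i \<in> atoms"
  using rep_atom by (auto simp: representatives_def)

lemma atom_class_atom: "e \<in> atom_class i \<Longrightarrow> e \<in> atoms" and atom_class_rep: "e \<in> atom_class i \<Longrightarrow> rep e = i"
  by (simp_all add: atom_class_def)

lemma mem_atom_class_rep: "e \<in> atoms \<Longrightarrow> e \<in> atom_class (rep e) \<and> rep e \<in> representatives"
  by (simp add: atom_class_def representatives_def)

lemma group_block: "i \<in> representatives \<Longrightarrow> group (maximal_subgroup i)"
  using group_maximal_subgroup representative_atom atom_idem by blast

lemma block_locale: "i \<in> representatives \<Longrightarrow> rook_matrices_over_group (maximal_subgroup i)"
  using group_block by (simp add: rook_matrices_over_group_def)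

lemma entries_component:
  assumes i: "i \<in> representatives"
  shows "(e, f, y) \<in> block_entries i (component s i) \<longleftrightarrow>
    e \<in> atom_class i \<and> f \<in> atom_class i \<and> y = coord s e f \<and> y \<noteq> \<zero>"
proof -
  interpret R: rook_matrices_over_group "maximal_subgroup i" "atom_class i"
    using i by (rule block_locale)
  show ?thesis by (auto simp: R.entries_iff component_def)
qed

text \<open>A non-zero corner of \<open>s\<close> lies below \<open>s\<close> and remembers \<open>e\<close> and \<open>f\<close> as its range and domain.\<close>

lemma finite_corners:
  assumes s: "s \<in> carrier S"
  shows "finite {(e, f). e \<in> atoms \<and> f \<in> atoms \<and> e \<cdot> (s \<cdot> f) \<noteq> \<zero>}" (is "finite ?P")
proof -
  have "(\<lambda>(e, f). e \<cdot> (s \<cdot> f)) ` ?P \<subseteq> {a \<in> carrier S. a \<preceq> s}"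
    using s corner_below by auto
  then have "finite ((\<lambda>(e, f). e \<cdot> (s \<cdot> f)) ` ?P)"
    using finite_below[OF s] finite_subset by blast
  moreover have "inj_on (\<lambda>(e, f). e \<cdot> (s \<cdot> f)) ?P"
  proof (rule inj_onI, clarify)
    fix e f e' f'
    assume a: "e \<in> atoms" "f \<in> atoms" "e \<cdot> (s \<cdot> f) \<noteq> \<zero>" "e' \<in> atoms" "f' \<in> atoms" "e' \<cdot> (s \<cdot> f') \<noteq> \<zero>"
      and eq: "e \<cdot> (s \<cdot> f) = e' \<cdot> (s \<cdot> f')"
    show "e = e' \<and> f = f'"
      using corner[OF a(1,2) s a(3)] corner[OF a(4,5) s a(6)] unfolding eq by metis
  qed
  ultimately show ?thesis by (rule finite_imageD)
qed

lemma component_closed: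
  assumes i: "i \<in> representatives" and s: "s \<in> carrier S"
  shows "component s i \<in> carrier (block i)"
proof -
  interpret R: rook_matrices_over_group "maximal_subgroup i" "atom_class i"
    using i by (rule block_locale)
  let ?N = "R.entries (component s i)"
  note mem = entries_component[OF i, of _ _ _ s]
  have corner: "e \<in> atoms \<and> f \<in> atoms \<and> e \<cdot> (s \<cdot> f) \<noteq> \<zero>" if "(e, f, y) \<in> ?N" for e f y
    using that coord_zero_iff[OF s] atom_class_atom unfolding mem by blast
  have "?N \<subseteq> (\<lambda>(e, f). (e, f, coord s e f)) ` {(e, f). e \<in> atoms \<and> f \<in> atoms \<and> e \<cdot> (s \<cdot> f) \<noteq> \<zero>}"
  proof clarify
    fix e f y assume N: "(e, f, y) \<in> ?N"
    then have "y = coord s e f" unfolding mem by blast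
    then show "(e, f, y) \<in> (\<lambda>(e, f). (e, f, coord s e f)) ` {(e, f). e \<in> atoms \<and> f \<in> atoms \<and> e \<cdot> (s \<cdot> f) \<noteq> \<zero>}"
      using corner[OF N] by auto
  qed
  then have "finite ?N" using finite_corners[OF s] finite_surj by blast
  moreover have "?N \<subseteq> atom_class i \<times> atom_class i \<times> carrier (maximal_subgroup i)"
    using coord_group[OF s] mem by auto
  moreover have "f = f' \<and> y = y'" if N: "(e, f, y) \<in> ?N" "(e, f', y') \<in> ?N" for e f f' y y'
  proof -
    have "f' = f" using corner[OF N(1)] corner[OF N(2)] corner_row(2)[OF s] by blast
    then show ?thesis using N unfolding mem by simp
  qed
  moreover have "e = e' \<and> y = y'" if N: "(e, f, y) \<in> ?N" "(e', f, y') \<in> ?N" for e e' f y y'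
  proof -
    have "e' = e" using corner[OF N(1)] corner[OF N(2)] corner_column[OF s] by blast
    then show ?thesis using N unfolding mem by simp
  qed
  ultimately have "R.rook_relation ?N" unfolding R.rook_relation_def by blast
  moreover have "component s i \<in> extensional (atom_class i \<times> atom_class i)"
    by (simp add: component_def)
  ultimately show ?thesis by (simp add: R.carrier_M_iff)
qed

text \<open>A non-zero entry of the matrix of \<open>s \<cdot> t\<close> in row \<open>e\<close> has exactly one factorization through an
  atom \<open>g\<close>, the domain of \<open>e \<cdot> s\<close>, and passing through this \<open>g\<close> changes nothing. Conversely, a product
  of two non-zero coordinates is a product in a group, hence non-zero.\<close>

lemma component_mult:
  assumes i: "i \<in> representatives" and s: "s \<in> carrier S" and t: "t \<in> carrier S"
  shows "component (s \<cdot> t) i = component s i \<cdot>\<^bsub>block i\<^esub> component t i"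
proof -
  interpret R: rook_matrices_over_group "maximal_subgroup i" "atom_class i"
    using i by (rule block_locale)
  note mem = entries_component[OF i]
  have product: "coord s e g \<cdot> coord t g f = \<iota> (link e) \<cdot> (s \<cdot> (g \<cdot> (t \<cdot> link f)))"
    if "e \<in> atoms" "f \<in> atoms" "g \<in> atoms" for e f g
    unfolding coord_def using that s t link(1) link_left(1)[OF that(3)] by simp
  \<comment> \<open>\<open>g\<close> can be dropped, because \<open>e \<cdot> (s \<cdot> g) = e \<cdot> s\<close> once the left-hand side is not \<open>\<zero>\<close>\<close>
  have skip: "coord s e g \<cdot> coord t g f = coord (s \<cdot> t) e f"
    if efg: "e \<in> atoms" "f \<in> atoms" "g \<in> atoms" and nz: "e \<cdot> (s \<cdot> g) \<noteq> \<zero>" for e f g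
  proof -
    have "\<iota> (link e) \<cdot> (s \<cdot> (g \<cdot> (t \<cdot> link f))) = \<iota> (link e) \<cdot> (e \<cdot> (s \<cdot> g) \<cdot> (t \<cdot> link f))"
      using efg s t link(1) link_left(3)[OF efg(1)] by simp
    also have "\<dots> = \<iota> (link e) \<cdot> (e \<cdot> s \<cdot> (t \<cdot> link f))"
      unfolding corner_row(1)[OF s efg(1,3) nz] ..
    also have "\<dots> = coord (s \<cdot> t) e f"
      using efg s t link(1) link_left(3)[OF efg(1)] by (simp add: coord_def)
    finally show ?thesis using product[OF efg] by simp
  qed
  have mult: "mult (maximal_subgroup i) = (\<cdot>)" by (simp add: maximal_subgroup_def)
  have "(e, f, y) \<in> R.entries (component (s \<cdot> t) i) \<longleftrightarrow>
      (e, f, y) \<in> R.rel_mult (R.entries (component s i)) (R.entries (component t i))" for e f y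
  proof
    assume "(e, f, y) \<in> R.entries (component (s \<cdot> t) i)"
    then have ef: "e \<in> atom_class i" "f \<in> atom_class i" and y: "y = coord (s \<cdot> t) e f" "y \<noteq> \<zero>"
      unfolding mem by auto
    have at: "e \<in> atoms" "f \<in> atoms" using ef atom_class_atom by blast+
    have nz: "e \<cdot> (s \<cdot> t \<cdot> f) \<noteq> \<zero>" using y coord_zero_iff at s t by simp
    have "e \<cdot> (s \<cdot> t \<cdot> f) = e \<cdot> s \<cdot> (t \<cdot> f)" using s t at by simp
    then have "e \<cdot> s \<noteq> \<zero>" using nz at t by auto
    then obtain g where g: "g \<in> atoms" "e \<cdot> (s \<cdot> g) = e \<cdot> s" using ex_corner_column[OF s at(1)] by blast
    have nzg: "e \<cdot> (s \<cdot> g) \<noteq> \<zero>" using g(2) \<open>e \<cdot> s \<noteq> \<zero>\<close> by simp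
    have gi: "g \<in> atom_class i"
      using corner_class[OF s at(1) g(1) nzg] ef(1) g(1) by (simp add: atom_class_def)
    have prod: "y = coord s e g \<cdot> coord t g f" using skip[OF at g(1) nzg] y(1) by simp
    have "coord s e g \<noteq> \<zero>" "coord t g f \<noteq> \<zero>"
      using prod y(2) coord_closed s t at g(1) by auto
    then have "(e, g, coord s e g) \<in> R.entries (component s i)" "(g, f, coord t g f) \<in> R.entries (component t i)"
      using ef gi unfolding mem by auto
    then show "(e, f, y) \<in> R.rel_mult (R.entries (component s i)) (R.entries (component t i))"
      using prod unfolding R.rel_mult_def mult by blast
  next
    assume "(e, f, y) \<in> R.rel_mult (R.entries (component s i)) (R.entries (component t i))"
    then obtain g a b where ab: "(e, g, a) \<in> R.entries (component s i)" "(g, f, b) \<in> R.entries (component t i)"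
      and y: "y = a \<cdot> b"
      unfolding R.rel_mult_def mult by blast
    then have efg: "e \<in> atom_class i" "g \<in> atom_class i" "f \<in> atom_class i"
      and a: "a = coord s e g" "a \<noteq> \<zero>" and b: "b = coord t g f" "b \<noteq> \<zero>"
      unfolding mem by auto
    have at: "e \<in> atoms" "f \<in> atoms" "g \<in> atoms" using efg atom_class_atom by blast+
    have "a \<in> carrier (maximal_subgroup i)" "b \<in> carrier (maximal_subgroup i)"
      using coord_group[OF s efg(1,2)] coord_group[OF t efg(2,3)] a b by auto
    then have "y \<in> carrier (maximal_subgroup i)" using R.m_closed[of a b] y unfolding mult by simp
    then have "y \<cdot> \<iota> y = i" "y \<in> carrier S" by (simp_all add: mem_maximal_subgroup)
    then have "y \<noteq> \<zero>" using atom_nonzero[OF representative_atom[OF i]] by auto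
    moreover have "e \<cdot> (s \<cdot> g) \<noteq> \<zero>" using a coord_zero_iff[OF s at(1,3)] by simp
    then have "y = coord (s \<cdot> t) e f" using skip[OF at] a(1) b(1) y by simp
    ultimately show "(e, f, y) \<in> R.entries (component (s \<cdot> t) i)"
      using efg unfolding mem by blast
  qed
  then have "R.entries (component (s \<cdot> t) i) = R.rel_mult (R.entries (component s i)) (R.entries (component t i))"
    by auto
  then show ?thesis
    using component_closed[OF i] s t R.mult_closed R.entries_mult by (intro R.matrix_eqI) simp_all
qed

lemma entries_block_szero:
  assumes i: "i \<in> representatives" and A: "A \<in> carrier (block i)"
  shows "A \<noteq> szero (block i) \<longleftrightarrow> block_entries i A \<noteq> {}"
proof -
  interpret R: rook_matrices_over_group "maximal_subgroup i" "atom_class i"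
    using i by (rule block_locale)
  show ?thesis using A R.entries_szero_M R.matrix_eqI by metis
qed

abbreviation block_product where "block_product \<equiv> restricted_direct_product representatives block"

lemma mem_block_product:
  "F \<in> carrier block_product \<longleftrightarrow> F \<in> (\<Pi>\<^sub>E i\<in>representatives. carrier (block i)) \<and>
    finite {i \<in> representatives. F i \<noteq> szero (block i)}"
  by (simp add: restricted_direct_product_def direct_product_def)

lemma decomposition_closed:
  assumes s: "s \<in> carrier S"
  shows "decomposition s \<in> carrier block_product"
proof -
  have "{i \<in> representatives. decomposition s i \<noteq> szero (block i)} \<subseteq>
      (\<lambda>(e, f). rep e) ` {(e, f). e \<in> atoms \<and> f \<in> atoms \<and> e \<cdot> (s \<cdot> f) \<noteq> \<zero>}"
  proof clarify
    fix i assume i: "i \<in> representatives" and "decomposition s i \<noteq> szero (block i)"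
    then have "block_entries i (component s i) \<noteq> {}"
      using entries_block_szero component_closed[OF i s] by (simp add: decomposition_def)
    then obtain e f y where "(e, f, y) \<in> block_entries i (component s i)" by auto
    then have ef: "e \<in> atom_class i" "f \<in> atom_class i" "coord s e f \<noteq> \<zero>"
      unfolding entries_component[OF i] by auto
    then have "(e, f) \<in> {(e, f). e \<in> atoms \<and> f \<in> atoms \<and> e \<cdot> (s \<cdot> f) \<noteq> \<zero>}" "i = rep e"
      using coord_zero_iff[OF s] atom_class_atom atom_class_rep by auto
    then show "i \<in> (\<lambda>(e, f). rep e) ` {(e, f). e \<in> atoms \<and> f \<in> atoms \<and> e \<cdot> (s \<cdot> f) \<noteq> \<zero>}"
      by force
  qed
  then have "finite {i \<in> representatives. decomposition s i \<noteq> szero (block i)}"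
    using finite_corners[OF s] finite_surj by blast
  then show ?thesis
    using component_closed[OF _ s] unfolding mem_block_product by (auto simp: decomposition_def)
qed

lemma decomposition_mult:
  assumes s: "s \<in> carrier S" and t: "t \<in> carrier S"
  shows "decomposition (s \<cdot> t) = decomposition s \<cdot>\<^bsub>block_product\<^esub> decomposition t"
  using component_mult[OF _ s t]
  by (auto simp: decomposition_def restricted_direct_product_def direct_product_def restrict_def)

text \<open>Corners between atoms of different classes are \<open>\<zero>\<close>, and the others can be read off from the
  coordinates; so equal decompositions mean equal corners.\<close>

lemma decomposition_inj: "inj_on decomposition (carrier S)"
proof (rule inj_onI)
  fix s t assume s: "s \<in> carrier S" and t: "t \<in> carrier S" and eq: "decomposition s = decomposition t"
  have "e \<cdot> (s \<cdot> f) = e \<cdot> (t \<cdot> f)" if ef: "e \<in> atoms" "f \<in> atoms" for e f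
  proof (cases "rep e = rep f")
    case True
    define i where "i = rep e"
    have i: "i \<in> representatives" "e \<in> atom_class i" "f \<in> atom_class i"
      using True mem_atom_class_rep[OF ef(1)] mem_atom_class_rep[OF ef(2)] unfolding i_def by simp_all
    have "component s i = component t i" using fun_cong[OF eq, of i] i(1) by (simp add: decomposition_def)
    then have "component s i (e, f) = component t i (e, f)" by simp
    then have "coord s e f = coord t e f" using i by (simp add: component_def split: if_splits)
    then show ?thesis using link_coord_link[OF s ef] link_coord_link[OF t ef] by simp
  next
    case False
    then show ?thesis using corner_class[OF s ef] corner_class[OF t ef] by metis
  qed
  then show "s = t" using nle_if_corners_eq s t by (intro nle_antisym) auto
qed

text \<open>The preimage is the join \<open>s\<close> of the elements \<open>link e \<cdot> (y \<cdot> \<iota> (link f))\<close>, for \<open>y\<close> the entry of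
  \<open>F\<close> at \<open>(e, f)\<close>. Each of them lies below \<open>s\<close> and is therefore the corner \<open>e \<cdot> (s \<cdot> f)\<close>. No further corner is
  non-zero, since an atom \<open>e\<close> that is not the range of a joined element kills all of them, and hence \<open>s\<close>.\<close>

lemma decomposition_surj:
  assumes F: "F \<in> carrier block_product"
  shows "\<exists>s \<in> carrier S. decomposition s = F"
proof -
  \<comment> \<open>all non-zero entries of \<open>F\<close>, each with its block and its position\<close>
  define P where "P = (SIGMA i:{i \<in> representatives. F i \<noteq> szero (block i)}. block_entries i (F i))"
  define atom_of where "atom_of = (\<lambda>(i :: 'a, e, f, y). link e \<cdot> (y \<cdot> \<iota> (link f)))"
  have block: "rook_matrices_over_group (maximal_subgroup i)" "F i \<in> carrier (block i)"
    "rook_matrices_over_group.rook_relation (maximal_subgroup i) (atom_class i) (block_entries i (F i))"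
    if i: "i \<in> representatives" for i
  proof -
    interpret R: rook_matrices_over_group "maximal_subgroup i" "atom_class i"
      using i by (rule block_locale)
    show "rook_matrices_over_group (maximal_subgroup i)" using i by (rule block_locale)
    show "F i \<in> carrier (block i)" using F i unfolding mem_block_product by blast
    then show "R.rook_relation (R.entries (F i))" by (rule R.entries_rook)
  qed
  have P_iff: "(i, e, f, y) \<in> P \<longleftrightarrow> i \<in> representatives \<and> (e, f, y) \<in> block_entries i (F i)" for i e f y
    using entries_block_szero block(2) unfolding P_def by blast
  have entry: "e \<in> atoms" "f \<in> atoms" "rep e = i" "rep f = i" "y \<in> carrier S" "y \<cdot> \<iota> y = i" "\<iota> y \<cdot> y = i"
    "e \<in> atom_class i" "f \<in> atom_class i" "i \<in> representatives"
    if "(i, e, f, y) \<in> P" for i e f y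
  proof -
    have i: "i \<in> representatives" and y: "(e, f, y) \<in> block_entries i (F i)" using that P_iff by auto
    note c = rook_matrices_over_group.rook_relation_carrier[OF block(1)[OF i] block(3)[OF i] y]
    then show "e \<in> atoms" "f \<in> atoms" "rep e = i" "rep f = i" "y \<in> carrier S" "y \<cdot> \<iota> y = i"
      "\<iota> y \<cdot> y = i" "e \<in> atom_class i" "f \<in> atom_class i" "i \<in> representatives"
      using i by (auto simp: atom_class_def mem_maximal_subgroup)
  qed
  have row: "i' = i \<and> f' = f \<and> y' = y" if "(i, e, f, y) \<in> P" "(i', e, f', y') \<in> P" for i i' e f f' y y'
  proof -
    have "i' = i" using entry(3)[OF that(1)] entry(3)[OF that(2)] by simp
    then show ?thesis
      using that P_iff rook_matrices_over_group.rook_relation_row[OF block(1) block(3), of i e f y f' y'] by blast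
  qed
  have column: "i' = i \<and> e' = e \<and> y' = y" if "(i, e, f, y) \<in> P" "(i', e', f, y') \<in> P" for i i' e e' f y y'
  proof -
    have "i' = i" using entry(4)[OF that(1)] entry(4)[OF that(2)] by simp
    then show ?thesis
      using that P_iff rook_matrices_over_group.rook_relation_column[OF block(1) block(3), of i e f y e' y'] by blast
  qed
  have "finite P"
    unfolding P_def
  proof (rule finite_SigmaI)
    show "finite {i \<in> representatives. F i \<noteq> szero (block i)}" using F unfolding mem_block_product by blast
    show "finite (block_entries i (F i))" if "i \<in> {i \<in> representatives. F i \<noteq> szero (block i)}" for i
      using that block(3)[of i] rook_matrices_over_group.rook_relation_def[OF block(1)[of i]] by blast
  qed
  have atom: "atom_of (i, e, f, y) \<in> carrier S" "atom_of (i, e, f, y) \<cdot> \<iota> (atom_of (i, e, f, y)) = e"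
    "\<iota> (atom_of (i, e, f, y)) \<cdot> atom_of (i, e, f, y) = f" "\<iota> (link e) \<cdot> (atom_of (i, e, f, y) \<cdot> link f) = y"
    if p: "(i, e, f, y) \<in> P" for i e f y
  proof -
    note e = entry[OF p]
    note l = link[OF e(1)] link[OF e(2)]
    have iy: "i \<cdot> y = y" unfolding e(6)[symmetric] using e(5) by simp
    have yi: "y \<cdot> i = y" unfolding e(7)[symmetric] using e(5) by simp
    have i: "i \<in> atoms" using representative_atom e(10) by blast
    have a: "atom_of (i, e, f, y) = link e \<cdot> (y \<cdot> \<iota> (link f))" by (simp add: atom_of_def)
    show c: "atom_of (i, e, f, y) \<in> carrier S" unfolding a using e(5) l by simp
    have "\<iota> (link e) \<cdot> (atom_of (i, e, f, y) \<cdot> link f) = (\<iota> (link e) \<cdot> link e) \<cdot> (y \<cdot> (\<iota> (link f) \<cdot> link f))"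
      unfolding a using e(5) l(1,4) by simp
    also have "\<dots> = y" unfolding l(2,5) e(3,4) using iy yi i e(5) by simp
    finally show y: "\<iota> (link e) \<cdot> (atom_of (i, e, f, y) \<cdot> link f) = y" .
    have nz: "atom_of (i, e, f, y) \<noteq> \<zero>"
    proof
      assume "atom_of (i, e, f, y) = \<zero>"
      then have "y = \<zero>" using y l(1,4) by simp
      then show False using e(6) atom_nonzero[OF i] by simp
    qed
    have "e \<cdot> atom_of (i, e, f, y) = atom_of (i, e, f, y)" unfolding a
      using prod_assoc[of e "link e" "y \<cdot> \<iota> (link f)"] link_right(1)[OF e(1)] e(1,5) l(1,4) by simp
    then show "atom_of (i, e, f, y) \<cdot> \<iota> (atom_of (i, e, f, y)) = e" using ran_eq_atom[OF e(1) c nz] by simp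
    have "atom_of (i, e, f, y) \<cdot> f = atom_of (i, e, f, y)" unfolding a
      using link_right(2)[OF e(2)] e(2,5) l(1,4) by simp
    then show "\<iota> (atom_of (i, e, f, y)) \<cdot> atom_of (i, e, f, y) = f" using dom_eq_atom[OF e(2) c nz] by simp
  qed
  have orth: "\<iota> a \<cdot> b = \<zero> \<and> a \<cdot> \<iota> b = \<zero>" if ab: "a \<in> atom_of ` P" "b \<in> atom_of ` P" "a \<noteq> b" for a b
  proof -
    obtain i e f y i' e' f' y' where p: "(i, e, f, y) \<in> P" "a = atom_of (i, e, f, y)"
      "(i', e', f', y') \<in> P" "b = atom_of (i', e', f', y')"
      using ab by auto
    note a = atom(1-3)[OF p(1), folded p(2)] and b = atom(1-3)[OF p(3), folded p(4)]
    have "e \<noteq> e'" "f \<noteq> f'" using row[OF p(1)] column[OF p(1)] p ab(3) by blast+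
    then have 0: "e \<cdot> e' = \<zero>" "f \<cdot> f' = \<zero>"
      using atoms_orthogonal entry(1,2)[OF p(1)] entry(1,2)[OF p(3)] by blast+
    have "\<iota> a \<cdot> b = \<iota> a \<cdot> (a \<cdot> \<iota> a \<cdot> (b \<cdot> \<iota> b)) \<cdot> b" using a(1) b(1) by simp
    also have "\<dots> = \<zero>" unfolding a(2) b(2) 0 using a(1) b(1) by simp
    finally have 1: "\<iota> a \<cdot> b = \<zero>" .
    have "a \<cdot> \<iota> b = a \<cdot> (\<iota> a \<cdot> a \<cdot> (\<iota> b \<cdot> b)) \<cdot> \<iota> b" using a(1) b(1) by simp
    also have "\<dots> = \<zero>" unfolding a(3) b(3) 0 using a(1) b(1) by simp
    finally show ?thesis using 1 by simp
  qed
  have "finite (atom_of ` P)" "atom_of ` P \<subseteq> carrier S" using \<open>finite P\<close> atom(1) by auto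
  then obtain s where s: "s \<in> carrier S" "\<forall>a \<in> atom_of ` P. a \<preceq> s"
    "\<forall>c \<in> carrier S. (\<forall>a \<in> atom_of ` P. c \<cdot> a = \<zero>) \<longrightarrow> c \<cdot> s = \<zero>"
    using ex_orthogonal_join[of "atom_of ` P", OF _ _ orth] by blast
  have coord: "coord s e f = y" if p: "(i, e, f, y) \<in> P" for i e f y
  proof -
    define a where "a = atom_of (i, e, f, y)"
    note a = atom[OF p, folded a_def] and ef = entry(1,2)[OF p]
    have "a \<preceq> s" using bspec[OF s(2) imageI[OF p]] by (simp add: a_def)
    then have "a = e \<cdot> s" using nle_ran[OF a(1) s(1)] a(1,2) s(1) prod_assoc[of a "\<iota> a" s] by simp
    moreover have "a \<cdot> f = a" using mult_sinv_mult[OF a(1)] unfolding a(3) .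
    ultimately have "e \<cdot> (s \<cdot> f) = a" using s(1) ef by simp
    then show ?thesis using coord_corner[OF s(1) ef] a(4) by simp
  qed
  have "component s i = F i" if i: "i \<in> representatives" for i
  proof -
    interpret R: rook_matrices_over_group "maximal_subgroup i" "atom_class i"
      using i by (rule block_locale)
    note mem = entries_component[OF i]
    have forward: "(e, f, y) \<in> R.entries (component s i)" if "(e, f, y) \<in> R.entries (F i)" for e f y
    proof -
      have p: "(i, e, f, y) \<in> P" using that i P_iff by blast
      have "y \<noteq> \<zero>" using entry(6)[OF p] atom_nonzero[OF representative_atom[OF i]] by auto
      then show ?thesis using coord[OF p] entry(8,9)[OF p] unfolding mem by simp
    qed
    have "(e, f, y) \<in> R.entries (F i)" if N: "(e, f, y) \<in> R.entries (component s i)" for e f y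
    proof -
      have ef: "e \<in> atom_class i" "f \<in> atom_class i" and y: "y = coord s e f" "y \<noteq> \<zero>"
        using N unfolding mem by auto
      have at: "e \<in> atoms" "f \<in> atoms" using ef atom_class_atom by blast+
      have "e \<cdot> (s \<cdot> f) \<noteq> \<zero>" using y coord_zero_iff[OF s(1) at] by simp
      moreover have "e \<cdot> (s \<cdot> f) = e \<cdot> s \<cdot> f" using at s(1) by simp
      ultimately have "e \<cdot> s \<noteq> \<zero>" using at by auto
      then obtain a where "a \<in> atom_of ` P" "e \<cdot> a \<noteq> \<zero>" using s(3) at(1) by (metis atom_idem idem_carrier)
      then obtain i' e' f' y' where p: "(i', e', f', y') \<in> P" "e \<cdot> atom_of (i', e', f', y') \<noteq> \<zero>" by auto
      define a where "a = atom_of (i', e', f', y')"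
      note a = atom[OF p(1), folded a_def]
      have "e \<cdot> a = e \<cdot> (a \<cdot> \<iota> a) \<cdot> a" using a(1) at(1) by simp
      then have "e \<cdot> e' \<noteq> \<zero>" using p(2) a(1) unfolding a(2) a_def[symmetric] by auto
      then have e': "e' = e" using atoms_orthogonal at(1) entry(1)[OF p(1)] by blast
      have "i' = i" using entry(3)[OF p(1)] atom_class_rep[OF ef(1)] e' by simp
      then have F': "(e, f', y') \<in> R.entries (F i)" using p(1) P_iff e' by blast
      have "f' = f" "y' = y"
        using R.rook_relation_row[OF R.entries_rook[OF component_closed[OF i s(1)]] N forward[OF F']] .
      then show ?thesis using F' by simp
    qed
    then have "R.entries (component s i) = R.entries (F i)" using forward by auto
    then show ?thesis using R.matrix_eqI component_closed[OF i s(1)] block(2)[OF i] by blast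
  qed
  moreover have "F \<in> extensional representatives" using F unfolding mem_block_product by (auto simp: PiE_def)
  ultimately have "decomposition s = F"
    by (intro extensionalityI[of _ representatives]) (auto simp: decomposition_def)
  then show ?thesis using s(1) by blast
qed

theorem isomorphic_block_product: "isomorphic S block_product"
proof -
  have "decomposition ` carrier S = carrier block_product"
    using decomposition_closed decomposition_surj by blast
  then have "bij_betw decomposition (carrier S) (carrier block_product)"
    using decomposition_inj by (simp add: bij_betw_def)
  then show ?thesis unfolding isomorphic_def using decomposition_mult by blast
qed

end

theorem theorem5p14:
  fixes S :: "'a semigrp"
  assumes "boolean_inverse_semigroup S"
    and "semisimple S"
  shows "\<exists>(I :: 'a set) (G :: 'a \<Rightarrow> 'a monoid) (X :: 'a \<Rightarrow> 'a set).
    (\<forall>i \<in> I. group (G i) \<and> X i \<noteq> {} \<and>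
      boolean_inverse_semigroup (rook_matrices (X i) (adjoin_zero (G i))) \<and>
      semisimple (rook_matrices (X i) (adjoin_zero (G i)))) \<and>
    isomorphic S (restricted_direct_product I (\<lambda>i. rook_matrices (X i) (adjoin_zero (G i))))"
proof -
  interpret S: semisimple_boolean_inverse_semigroup S
    using assms by (intro semisimple_boolean_inverse_semigroup.intro
        semisimple_boolean_inverse_semigroup_axioms.intro)
  have "group (S.maximal_subgroup i) \<and> S.atom_class i \<noteq> {} \<and>
      boolean_inverse_semigroup (S.block i) \<and> semisimple (S.block i)" if i: "i \<in> S.representatives" for i
  proof -
    have ne: "S.atom_class i \<noteq> {}"
      using i S.mem_atom_class_rep unfolding S.representatives_def by blast
    note R = S.block_locale[OF i]
    show ?thesis
      using ne S.group_block[OF i] rook_matrices_over_group.boolean_inverse_semigroup_M[OF R ne]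
        rook_matrices_over_group.semisimple_M[OF R] by (intro conjI)
  qed
  then show ?thesis
    using S.isomorphic_block_product
    by (intro exI[of _ S.representatives] exI[of _ S.maximal_subgroup] exI[of _ S.atom_class] conjI ballI) simp_all
qed

end
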